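(* The decision problem $\textsc{trSat}[\mathcal{T}_{\mathit{udec}}]$ is undecidable.
   Context: A transformer encoder (TE) $T$ over a finite alphabet $\Sigma$ with $L$ layers and $h_i$ attention heads in layer $i$ consists of: a positional embedding $\mathit{emb}\colon\Sigma\times\mathbb{N}\to\mathbb{R}^{d_0}$; for each $1\le i\le L$, $1\le j\le h_i$ an attention head $(\mathit{score}_{i,j},\mathit{pool}_{i,j})$ with scoring function $\mathit{score}_{i,j}\colon\mathbb{R}^{d_{i-1}}\times\mathbb{R}^{d_{i-1}}\to\mathbb{R}$ and pooling function $\mathit{pool}_{i,j}(\boldsymbol{x}_1,\dots,\boldsymbol{x}_n,s_1,\dots,s_n)=\sum_{i'=1}^n \mathit{norm}_{i,j}(i',s_1,\dots,s_n)\,W_{i,j}\boldsymbol{x}_{i'}$, where $W_{i,j}$ is a matrix and $\mathit{norm}_{i,j}$ is a normalisation function; for each layer $i$ a combination function $\mathit{comb}_i$; and an output function $\mathit{out}\colon\mathbb{R}^{d_L}\to\mathbb{R}$. On input $w=a_1\cdots a_n\in\Sigma^+$: $\boldsymbol{x}^0_m=\mathit{emb}(a_m,m)$; for each layer $i$ and head $j$, $\boldsymbol{y}^i_{m,j}=\mathit{pool}_{i,j}(\boldsymbol{x}^{i-1}_1,\dots,\boldsymbol{x}^{i-1}_n,\mathit{score}_{i,j}(\boldsymbol{x}^{i-1}_m,\boldsymbol{x}^{i-1}_1),\dots,\mathit{score}_{i,j}(\boldsymbol{x}^{i-1}_m,\boldsymbol{x}^{i-1}_n))$ and $\boldsymbol{x}^i_m=\mathit{comb}_i(\boldsymbol{x}^{i-1}_m,\boldsymbol{y}^i_{m,1},\dots,\boldsymbol{y}^i_{m,h_i})$;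 finally $T(w)=\mathit{out}(\boldsymbol{x}^L_n)$. For a class $\mathcal{C}$ of TE, $\textsc{trSat}[\mathcal{C}]$ is the problem: given $T\in\mathcal{C}$ over alphabet $\Sigma$, decide whether there is $w\in\Sigma^+$ with $T(w)=1$. The hardmax normalisation is $\mathrm{hardmax}(i,x_1,\dots,x_n)=\frac1m$ if $x_i\ge x_j$ for all $j\le n$, where $m$ is the number of indices $j$ with $x_j=x_i$, and $\mathrm{hardmax}(i,x_1,\dots,x_n)=0$ otherwise. $\mathcal{T}_{\mathit{udec}}$ is the class of TE with the following components allowed: positional embeddings of the form $\mathit{emb}(a_k,0)=(1,1,0,0,k)$ and $\mathit{emb}(a_k,i)=(0,1,i,\sum_{j=0}^{i}j,k)$ for $i\ge1$ (for a fixed enumeration $a_1,a_2,\dots$ of the alphabet); scoring functions of the form $(\boldsymbol{x},\boldsymbol{y})\mapsto N(\langle Q\boldsymbol{x},K\boldsymbol{y}\rangle)$ where $Q,K$ are linear maps, $\langle\cdot,\cdot\rangle$ is the standard scalar product and $N$ is a feed-forward neural network with ReLU activations; normalisation $\mathrm{hardmax}$; combination and output functions given by feed-forward neural networks with ReLU activations. *)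

theory Defs
  imports
    Complex_Main
    "HOL-Library.Nat_Bijection"
    "Jordan_Normal_Form.Matrix"
begin

record head =
  head_score :: "real vec \<Rightarrow> real vec \<Rightarrow> real"
  head_norm :: "nat \<Rightarrow> real list \<Rightarrow> real"
  head_matrix :: "real mat"

record layer =
  layer_heads :: "head list"
  layer_comb :: "real vec \<Rightarrow> real vec list \<Rightarrow> real vec"

record 'a te =
  te_alphabet :: "'a set"
  te_emb :: "'a \<Rightarrow> nat \<Rightarrow> real vec"
  te_layers :: "layer list"
  te_out :: "real vec \<Rightarrow> real"

definition pool :: "head \<Rightarrow> real vec list \<Rightarrow> real list \<Rightarrow> real vec" where
  "pool H xs ss = vec (dim_row (head_matrix H))
     (\<lambda>r. \<Sum>i<length xs. head_norm H i ss * (head_matrix H *\<^sub>v (xs ! i)) $ r)"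

definition attend :: "head \<Rightarrow> real vec list \<Rightarrow> real vec \<Rightarrow> real vec" where
  "attend H xs x = pool H xs (map (head_score H x) xs)"

definition layer_step :: "layer \<Rightarrow> real vec list \<Rightarrow> real vec list" where
  "layer_step l xs =
     map (\<lambda>x. layer_comb l x (map (\<lambda>H. attend H xs x) (layer_heads l))) xs"

text \<open>Lists are indexed from 0, whereas the positions handed to the embedding are
  \<open>1, \<dots>, n\<close>: the \<open>m\<close>-th letter of the word is embedded at position \<open>m\<close>.\<close>

definition embed_word :: "'a te \<Rightarrow> 'a list \<Rightarrow> real vec list" where
  "embed_word T w = map (\<lambda>m. te_emb T (w ! m) (Suc m)) [0..<length w]"

definition te_run :: "'a te \<Rightarrow> 'a list \<Rightarrow> real" where
  "te_run T w = te_out T (last (fold layer_step (te_layers T) (embed_word T w)))"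

definition te_satisfiable :: "'a te \<Rightarrow> bool" where
  "te_satisfiable T \<longleftrightarrow> (\<exists>w. w \<noteq> [] \<and> set w \<subseteq> te_alphabet T \<and> te_run T w = 1)"

definition hardmax :: "nat \<Rightarrow> real list \<Rightarrow> real" where
  "hardmax i xs =
     (if \<forall>j<length xs. xs ! j \<le> xs ! i
      then 1 / real (card {j. j < length xs \<and> xs ! j = xs ! i}) else 0)"

text \<open>The inputs of a decision problem are finite objects, so all weights are rational.
  \<open>Hidden A b N\<close> applies \<open>x \<mapsto> relu (A x + b)\<close> and then \<open>N\<close>; the output layer is affine.\<close>

datatype fnn = Output "rat mat" "rat vec" | Hidden "rat mat" "rat vec" fnn

abbreviation real_mat :: "rat mat \<Rightarrow> real mat" where
  "real_mat \<equiv> map_mat real_of_rat"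

definition affine :: "rat mat \<Rightarrow> rat vec \<Rightarrow> real vec \<Rightarrow> real vec" where
  "affine A b x = real_mat A *\<^sub>v x + map_vec real_of_rat b"

definition relu :: "real \<Rightarrow> real" where
  "relu x = max 0 x"

primrec fnn_eval :: "fnn \<Rightarrow> real vec \<Rightarrow> real vec" where
  "fnn_eval (Output A b) x = affine A b x"
| "fnn_eval (Hidden A b N) x = fnn_eval N (map_vec relu (affine A b x))"

definition fnn_scalar :: "fnn \<Rightarrow> real vec \<Rightarrow> real" where
  "fnn_scalar N x = fnn_eval N x $ 0"

primrec fnn_wf :: "nat \<Rightarrow> nat \<Rightarrow> fnn \<Rightarrow> bool" where
  "fnn_wf m n (Output A b) \<longleftrightarrow> A \<in> carrier_mat n m \<and> b \<in> carrier_vec n"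
| "fnn_wf m n (Hidden A b N) \<longleftrightarrow>
     (\<exists>k. A \<in> carrier_mat k m \<and> b \<in> carrier_vec k \<and> fnn_wf k n N)"

record udec_head =
  uh_query :: "rat mat"
  uh_key :: "rat mat"
  uh_net :: fnn
  uh_matrix :: "rat mat"

record udec_layer =
  ul_heads :: "udec_head list"
  ul_comb :: fnn

text \<open>The letter \<open>a\<^sub>k\<close> is represented by its index \<open>k\<close>; an alphabet with \<open>s\<close> letters is
  thus \<open>{1..s}\<close>.\<close>

record udec_te =
  ut_size :: nat
  ut_layers :: "udec_layer list"
  ut_out :: fnn

definition udec_emb :: "nat \<Rightarrow> nat \<Rightarrow> real vec" where
  "udec_emb k i = vec_of_list
     (if i = 0 then [1, 1, 0, 0, real k]
      else [0, 1, real i, (\<Sum>j=0..i. real j), real k])"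

definition head_of :: "udec_head \<Rightarrow> head" where
  "head_of H =
     \<lparr> head_score = (\<lambda>x y. fnn_scalar (uh_net H)
         (vec_of_list [(real_mat (uh_query H) *\<^sub>v x) \<bullet> (real_mat (uh_key H) *\<^sub>v y)])),
       head_norm = hardmax,
       head_matrix = real_mat (uh_matrix H) \<rparr>"

definition layer_of :: "udec_layer \<Rightarrow> layer" where
  "layer_of l =
     \<lparr> layer_heads = map head_of (ul_heads l),
       layer_comb = (\<lambda>x ys. fnn_eval (ul_comb l)
         (vec_of_list (list_of_vec x @ concat (map list_of_vec ys)))) \<rparr>"

definition te_of :: "udec_te \<Rightarrow> nat te" where
  "te_of P =
     \<lparr> te_alphabet = {1..ut_size P},
       te_emb = udec_emb,
       te_layers = map layer_of (ut_layers P),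
       te_out = fnn_scalar (ut_out P) \<rparr>"

definition head_wf :: "nat \<Rightarrow> udec_head \<Rightarrow> bool" where
  "head_wf d H \<longleftrightarrow>
     (\<exists>e. uh_query H \<in> carrier_mat e d \<and> uh_key H \<in> carrier_mat e d) \<and>
     fnn_wf 1 1 (uh_net H) \<and> dim_col (uh_matrix H) = d"

definition layer_wf :: "nat \<Rightarrow> nat \<Rightarrow> udec_layer \<Rightarrow> bool" where
  "layer_wf d d' l \<longleftrightarrow>
     (\<forall>H\<in>set (ul_heads l). head_wf d H) \<and>
     fnn_wf (d + (\<Sum>H\<leftarrow>ul_heads l. dim_row (uh_matrix H))) d' (ul_comb l)"

primrec layers_wf :: "nat \<Rightarrow> nat \<Rightarrow> udec_layer list \<Rightarrow> bool" where
  "layers_wf d d' [] \<longleftrightarrow> d = d'"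
| "layers_wf d d' (l # ls) \<longleftrightarrow> (\<exists>e. layer_wf d e l \<and> layers_wf e d' ls)"

definition T_udec :: "udec_te set" where
  "T_udec = {P. 1 \<le> ut_size P \<and> (\<exists>d. layers_wf 5 d (ut_layers P) \<and> fnn_wf d 1 (ut_out P))}"

definition trSat :: "udec_te \<Rightarrow> bool" where
  "trSat P \<longleftrightarrow> te_satisfiable (te_of P)"

definition rat_code :: "rat \<Rightarrow> nat" where
  "rat_code q = prod_encode (map_prod int_encode int_encode (quotient_of q))"

definition vec_code :: "rat vec \<Rightarrow> nat" where
  "vec_code v = list_encode (map rat_code (list_of_vec v))"

text \<open>The number of columns is recorded separately since it is lost when there are no rows.\<close>

definition mat_code :: "rat mat \<Rightarrow> nat" where
  "mat_code A = prod_encode (dim_col A, list_encode (map vec_code (rows A)))"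

primrec fnn_code :: "fnn \<Rightarrow> nat" where
  "fnn_code (Output A b) = list_encode [mat_code A, vec_code b]"
| "fnn_code (Hidden A b N) = list_encode [mat_code A, vec_code b, fnn_code N]"

definition head_code :: "udec_head \<Rightarrow> nat" where
  "head_code H = list_encode
     [mat_code (uh_query H), mat_code (uh_key H), fnn_code (uh_net H), mat_code (uh_matrix H)]"

definition layer_code :: "udec_layer \<Rightarrow> nat" where
  "layer_code l = prod_encode (list_encode (map head_code (ul_heads l)), fnn_code (ul_comb l))"

definition udec_code :: "udec_te \<Rightarrow> nat" where
  "udec_code P = list_encode
     [ut_size P, list_encode (map layer_code (ut_layers P)), fnn_code (ut_out P)]"

lemma list_encode_eq_iff [simp]: "list_encode xs = list_encode ys \<longleftrightarrow> xs = ys"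
  by (metis list_encode_inverse)

lemma inj_rat_code: "inj rat_code"
  unfolding rat_code_def
  by (rule injI) (auto simp: map_prod_def prod_encode_eq int_encode_eq split: prod.splits
      intro!: quotient_of_inject)

lemma inj_vec_code: "inj vec_code"
  unfolding vec_code_def
  by (rule injI) (metis inj_rat_code list_encode_eq_iff inj_map_eq_map vec_list)

lemma inj_mat_code: "inj mat_code"
proof (rule injI)
  fix A B :: "rat mat"
  assume "mat_code A = mat_code B"
  then have "dim_col A = dim_col B" "rows A = rows B"
    by (auto simp: mat_code_def prod_encode_eq inj_map_eq_map[OF inj_vec_code])
  then show "A = B"
    by (metis mat_of_rows_rows)
qed

lemma fnn_code_eq: "fnn_code M = fnn_code N \<Longrightarrow> M = N"
proof (induction M arbitrary: N)
  case (Output A b)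
  then show ?case
    by (cases N) (auto dest: injD[OF inj_mat_code] injD[OF inj_vec_code] simp del: list_encode.simps)
next
  case (Hidden A b M)
  then show ?case
    by (cases N) (auto dest: injD[OF inj_mat_code] injD[OF inj_vec_code] simp del: list_encode.simps)
qed

lemma inj_head_code: "inj head_code"
  by (rule injI)
    (auto simp: head_code_def simp del: list_encode.simps intro!: udec_head.equality
      dest: injD[OF inj_mat_code] fnn_code_eq)

lemma inj_layer_code: "inj layer_code"
  by (rule injI)
    (auto simp: layer_code_def prod_encode_eq inj_map_eq_map[OF inj_head_code]
      intro!: udec_layer.equality dest: fnn_code_eq)

lemma inj_udec_code: "inj udec_code"
  by (rule injI)
    (auto simp: udec_code_def inj_map_eq_map[OF inj_layer_code] simp del: list_encode.simps
      intro!: udec_te.equality dest: fnn_code_eq)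

text \<open>Kleene's partial recursive functions. The arity is that of the argument list, so a term
  stands for one partial function per arity. Primitive recursion is on the first argument, and
  \<open>Mu f\<close> minimises over the first argument of \<open>f\<close>.\<close>

datatype recf =
  Zero | Succ | Proj nat | Comp recf "recf list" | PrimRec recf recf | Mu recf

inductive computes :: "recf \<Rightarrow> nat list \<Rightarrow> nat \<Rightarrow> bool" where
  Zero: "computes Zero xs 0"
| Succ: "computes Succ (x # xs) (Suc x)"
| Proj: "i < length xs \<Longrightarrow> computes (Proj i) xs (xs ! i)"
| Comp: "\<lbrakk>length ys = length gs; \<And>i. i < length gs \<Longrightarrow> computes (gs ! i) xs (ys ! i);
    computes f ys z\<rbrakk> \<Longrightarrow> computes (Comp f gs) xs z"
| PrimRec_0: "computes f xs z \<Longrightarrow> computes (PrimRec f g) (0 # xs) z"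
| PrimRec_Suc: "\<lbrakk>computes (PrimRec f g) (n # xs) y; computes g (y # n # xs) z\<rbrakk>
    \<Longrightarrow> computes (PrimRec f g) (Suc n # xs) z"
| Mu: "\<lbrakk>computes f (n # xs) 0; \<And>m. m < n \<Longrightarrow> \<exists>y. computes f (m # xs) (Suc y)\<rbrakk>
    \<Longrightarrow> computes (Mu f) xs n"

lemma computes_deterministic: "computes f xs y \<Longrightarrow> computes f xs z \<Longrightarrow> y = z"
proof (induction arbitrary: z rule: computes.induct)
  case (Comp ys gs xs f y)
  from Comp.prems obtain ys' where ys': "length ys' = length gs"
    "\<And>i. i < length gs \<Longrightarrow> computes (gs ! i) xs (ys' ! i)" "computes f ys' z"
    by cases auto
  with Comp have "ys = ys'"
    by (metis nth_equalityI)
  with ys' Comp.IH show ?case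
    by blast
next
  case (Mu f n xs)
  from Mu.prems have z: "computes f (z # xs) 0"
    "\<And>m. m < z \<Longrightarrow> \<exists>y. computes f (m # xs) (Suc y)"
    by (cases; blast)+
  show ?case
  proof (rule linorder_cases[of n z])
    assume "n < z" with z Mu.IH show ?thesis by fastforce
  next
    assume "z < n" with z Mu.IH show ?thesis by fastforce
  qed
next
  case (PrimRec_0 f xs y g)
  from PrimRec_0.prems PrimRec_0.IH show ?case by (cases) auto
next
  case (PrimRec_Suc f g n xs y z')
  from PrimRec_Suc.prems PrimRec_Suc.IH show ?case by (cases) auto
qed (auto elim: computes.cases)

text \<open>The algorithm has to answer correctly on (codes of) instances only; inputs that are not
  codes of instances are left unconstrained.\<close>

definition decidable_problem :: "('p \<Rightarrow> nat) \<Rightarrow> 'p set \<Rightarrow> ('p \<Rightarrow> bool) \<Rightarrow> bool" where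
  "decidable_problem code I P \<longleftrightarrow>
     (\<exists>f. \<forall>p\<in>I. computes f [code p] (if P p then 1 else 0))"

end

theory Submission
  imports Defs
begin

text \<open>Suppose that a partial recursive function decides the problem. Every partial recursive
  function \<open>h\<close> is compiled to a register program, whose halting runs are words over its finite set
  of instructions. Whether a word is such a run is a matter of linear inequalities between the
  numbers of occurrences of letters in its prefixes, and these numbers, divided by the length of the
  prefix, are what a hardmax head computes that scores all earlier positions alike and the later
  ones worse. So there are layers \<open>ls\<^sub>h\<close> such that, for all \<open>n\<close>, the encoder consisting of a first
  layer that knows the number \<open>n\<close>, followed by \<open>ls\<^sub>h\<close>, is satisfiable iff \<open>h\<close> halts on \<open>n\<close>.
  No universal machine is needed: the code of \<open>ls\<^sub>h\<close> serves as the program number of \<open>h\<close>. The code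
  of the encoder for \<open>h\<close> and \<open>n = code ls\<^sub>h\<close> is a computable function of \<open>n\<close> alone, and the
  contradiction is reached with an \<open>h\<close> that halts on such \<open>n\<close> iff the supposed decision procedure
  answers no on this code.\<close>

section \<open>Register programs for partial recursive functions\<close>

datatype act = Skip | Inc nat | Dec nat | Tst nat

text \<open>\<open>Star\<close> may iterate any number of times. Control flow comes from blocking
  alone: \<open>Dec\<close> has no step at 0, and \<open>Tst\<close> has none at a positive
  register.\<close>

datatype prog = Act act | Seq prog prog | Star prog

primrec step :: "act \<Rightarrow> (nat \<Rightarrow> nat) \<Rightarrow> (nat \<Rightarrow> nat) \<Rightarrow> bool" where
  "step Skip s t \<longleftrightarrow> t = s"
| "step (Inc r) s t \<longleftrightarrow> t = s(r := Suc (s r))"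
| "step (Dec r) s t \<longleftrightarrow> 0 < s r \<and> t = s(r := s r - 1)"
| "step (Tst r) s t \<longleftrightarrow> s r = 0 \<and> t = s"

primrec sem :: "prog \<Rightarrow> (nat \<Rightarrow> nat) \<Rightarrow> (nat \<Rightarrow> nat) \<Rightarrow> bool" where
  "sem (Act a) = step a"
| "sem (Seq P Q) = sem P OO sem Q"
| "sem (Star P) = (sem P)\<^sup>*\<^sup>*"

text \<open>This is the loop \<open>while r > 0\<close> that decrements \<open>r\<close> before each
  pass: \<open>Tst\<close> forbids leaving too early, and \<open>Dec\<close> forbids a pass too
  many.\<close>

definition drain :: "nat \<Rightarrow> prog \<Rightarrow> prog" where
  "drain r P = Seq (Star (Seq (Act (Dec r)) P)) (Act (Tst r))"

definition clear :: "nat \<Rightarrow> prog" where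
  "clear r = drain r (Act Skip)"

definition move :: "nat \<Rightarrow> nat \<Rightarrow> prog" where
  "move a b = drain a (Act (Inc b))"

text \<open>Draining \<open>a\<close> destroys it, so a second copy is collected in the scratch
  register \<open>Suc b\<close>, from which \<open>a\<close> is restored.\<close>

definition copy :: "nat \<Rightarrow> nat \<Rightarrow> prog" where
  "copy a b = Seq (drain a (Seq (Act (Inc b)) (Act (Inc (Suc b))))) (move (Suc b) a)"

primrec clears :: "nat \<Rightarrow> nat \<Rightarrow> prog" where
  "clears 0 b = Act Skip"
| "clears (Suc n) b = Seq (clear b) (clears n (Suc b))"

text \<open>Taking compiled functions instead of terms keeps the recursion of \<open>compile\<close>
  primitive. Each function starts at the first register after the earlier results.\<close>

primrec arg_prog :: "(nat list \<Rightarrow> nat \<Rightarrow> prog) list \<Rightarrow> nat list \<Rightarrow> nat \<Rightarrow> prog" where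
  "arg_prog [] is b = Act Skip"
| "arg_prog (c # cs) is b = Seq (c is b) (arg_prog cs is (Suc b))"

text \<open>A program without any run; it stands for a term that is undefined at the given
  arity.\<close>

definition abort :: "nat \<Rightarrow> prog" where
  "abort b = Seq (Act (Inc b)) (Act (Tst b))"

text \<open>\<open>compile f is b\<close> reads its arguments from the registers \<open>is\<close>, all below \<open>b\<close>, and adds the
  result to register \<open>b\<close>. The registers from \<open>b\<close> on must be \<open>0\<close> at the start, and
  those above \<open>b\<close> are \<open>0\<close> again at the end.\<close>

primrec compile :: "recf \<Rightarrow> nat list \<Rightarrow> nat \<Rightarrow> prog" where
  "compile Zero is b = Act Skip"
| "compile Succ is b =
     (case is of [] \<Rightarrow> abort b | a # _ \<Rightarrow> Seq (copy a b) (Act (Inc b)))"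
| "compile (Proj i) is b = (if i < length is then copy (is ! i) b else abort b)"
| "compile (Comp f gs) is b =
     (let n = length gs in
      Seq (arg_prog (map compile gs) is (Suc b))
        (Seq (compile f [Suc b..<Suc b + n] (Suc b + n))
          (Seq (clears n (Suc b)) (move (Suc b + n) b))))"
| "compile (PrimRec f g) is b =
     (case is of [] \<Rightarrow> abort b
      | a # js \<Rightarrow>
        Seq (copy a (b + 1))
          (Seq (compile f js (b + 3))
            (Seq (move (b + 3) b)
              (Seq (drain (b + 1)
                  (Seq (compile g (b # (b + 2) # js) (b + 3))
                    (Seq (clear b) (Seq (move (b + 3) b) (Act (Inc (b + 2)))))))
                (clear (b + 2))))))"
| "compile (Mu f) is b =
     Seq (compile f (b # is) (b + 1))
       (drain (b + 1) (Seq (clear (b + 1)) (Seq (Act (Inc b)) (compile f (b # is) (b + 1)))))"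

section \<open>Semantics of the register macros\<close>

lemma sem_drain:
  "sem (drain r P) s t \<longleftrightarrow>
     (if s r = 0 then t = s else \<exists>u. sem P (s(r := s r - 1)) u \<and> sem (drain r P) u t)"
proof -
  have *: "R\<^sup>*\<^sup>* s u \<longleftrightarrow> u = s \<or> (\<exists>v. R s v \<and> R\<^sup>*\<^sup>* v u)" for R :: "(nat \<Rightarrow> nat) \<Rightarrow> _" and u
    by (blast elim: converse_rtranclpE intro: converse_rtranclp_into_rtranclp)
  show ?thesis
    unfolding drain_def sem.simps(2)[of "Star _"] relcompp_apply sem.simps(3)
    by (subst *) (auto simp: relcompp_apply)
qed

lemma sem_clear: "sem (clear r) s t \<longleftrightarrow> t = s(r := 0)"
proof (induction "s r" arbitrary: s)
  case 0
  then show ?case by (auto simp: clear_def sem_drain[of r _ s])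
next
  case (Suc n)
  from Suc(1)[of "s(r := n)"] Suc(2) show ?case
    by (auto simp: clear_def sem_drain[of r _ s] Suc(2)[symmetric])
qed

lemma sem_move: "a \<noteq> b \<Longrightarrow> sem (move a b) s t \<longleftrightarrow> t = s(b := s b + s a, a := 0)"
proof (induction "s a" arbitrary: s)
  case 0
  then show ?case by (auto simp: move_def sem_drain[of a _ s])
next
  case (Suc n)
  from Suc(1)[of "s(a := n, b := Suc (s b))"] Suc(2,3) show ?case
    by (simp add: move_def sem_drain[of a _ s] Suc(2)[symmetric] fun_upd_twist)
qed

lemma sem_drain2: "a \<noteq> b \<Longrightarrow> a \<noteq> c \<Longrightarrow> b \<noteq> c \<Longrightarrow>
  sem (drain a (Seq (Act (Inc b)) (Act (Inc c)))) s t \<longleftrightarrow>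
    t = s(b := s b + s a, c := s c + s a, a := 0)"
proof (induction "s a" arbitrary: s)
  case 0
  then show ?case by (auto simp: sem_drain[of a _ s])
next
  case (Suc n)
  from Suc(1)[of "s(a := n, b := Suc (s b), c := Suc (s c))"] Suc(2-) show ?case
    by (simp add: sem_drain[of a _ s] Suc(2)[symmetric] fun_upd_twist relcompp_apply)
qed

lemma sem_copy:
  assumes "a < b" "s (Suc b) = 0"
  shows "sem (copy a b) s t \<longleftrightarrow> t = s(b := s b + s a)"
proof -
  have "s(b := s b + s a, a := s a, Suc b := 0) = s(b := s b + s a)"
    using assms by (auto simp: fun_eq_iff)
  with assms show ?thesis
    by (simp add: copy_def sem_move sem_drain2 relcompp_apply fun_upd_twist)
qed

lemma sem_clears: "sem (clears n b) s t \<longleftrightarrow> t = (\<lambda>j. if b \<le> j \<and> j < b + n then 0 else s j)"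
proof (induction n arbitrary: b s)
  case (Suc n)
  have "(\<lambda>j. if Suc b \<le> j \<and> j < Suc b + n then 0 else (s(b := 0)) j) =
      (\<lambda>j. if b \<le> j \<and> j < b + Suc n then 0 else s j)"
    by (auto simp: fun_eq_iff)
  with Suc show ?case by (simp add: relcompp_apply sem_clear)
qed auto

lemma not_sem_abort: "\<not> sem (abort b) s t"
  by (simp add: abort_def relcompp_apply)

text \<open>The equivalence carries both halves of correctness: the right result where
  \<open>f\<close> is defined, and no terminating run where it is not.\<close>

definition runs :: "recf \<Rightarrow> bool" where
  "runs f \<longleftrightarrow> (\<forall>is b s t. (\<forall>i\<in>set is. i < b) \<longrightarrow> (\<forall>j\<ge>b. s j = 0) \<longrightarrow>
     (sem (compile f is b) s t \<longleftrightarrow> (\<exists>y. computes f (map s is) y \<and> t = s(b := y))))"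

lemma runsD: "runs f \<Longrightarrow> (\<And>i. i \<in> set is \<Longrightarrow> i < b) \<Longrightarrow> (\<And>j. b \<le> j \<Longrightarrow> s j = 0) \<Longrightarrow>
  sem (compile f is b) s t \<longleftrightarrow> (\<exists>y. computes f (map s is) y \<and> t = s(b := y))"
  unfolding runs_def by blast

inductive_simps computes_Zero: "computes Zero xs y"
inductive_simps computes_Succ: "computes Succ xs y"
inductive_simps computes_Proj: "computes (Proj i) xs y"
inductive_simps computes_Comp: "computes (Comp f gs) xs y"
inductive_simps computes_PrimRec_Nil: "computes (PrimRec f g) [] y"
inductive_simps computes_PrimRec_zero: "computes (PrimRec f g) (0 # xs) y"
inductive_simps computes_PrimRec_suc: "computes (PrimRec f g) (Suc n # xs) y"
inductive_simps computes_Mu: "computes (Mu f) xs y"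

primrec put :: "nat \<Rightarrow> nat list \<Rightarrow> (nat \<Rightarrow> nat) \<Rightarrow> nat \<Rightarrow> nat" where
  "put b [] s = s"
| "put b (y # ys) s = put (Suc b) ys (s(b := y))"

lemma put_apply: "put b ys s j = (if b \<le> j \<and> j < b + length ys then ys ! (j - b) else s j)"
  by (induction ys arbitrary: b s) (auto simp: nth_Cons')

lemma sem_arg_prog:
  assumes "\<And>g. g \<in> set gs \<Longrightarrow> runs g" "\<And>i. i \<in> set is \<Longrightarrow> i < b" "\<And>j. b \<le> j \<Longrightarrow> s j = 0"
  shows "sem (arg_prog (map compile gs) is b) s t \<longleftrightarrow>
    (\<exists>ys. list_all2 (\<lambda>g y. computes g (map s is) y) gs ys \<and> t = put b ys s)"
  using assms
proof (induction gs arbitrary: b s)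
  case (Cons g gs)
  have g: "sem (compile g is b) s u \<longleftrightarrow> (\<exists>y. computes g (map s is) y \<and> u = s(b := y))" for u
    by (rule runsD) (use Cons.prems in auto)
  have map: "map (s(b := y)) is = map s is" for y
    using Cons.prems(2) by fastforce
  have rest: "sem (arg_prog (map compile gs) is (Suc b)) (s(b := y)) t \<longleftrightarrow>
      (\<exists>ys. list_all2 (\<lambda>g y. computes g (map s is) y) gs ys \<and> t = put b (y # ys) s)" for y
    unfolding put.simps map[of y, symmetric]
    by (rule Cons.IH) (use Cons.prems in \<open>auto simp: less_Suc_eq\<close>)
  have "sem (arg_prog (map compile (g # gs)) is b) s t \<longleftrightarrow>
      (\<exists>y. computes g (map s is) y \<and> sem (arg_prog (map compile gs) is (Suc b)) (s(b := y)) t)"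
    by (simp add: relcompp_apply g) blast
  also have "\<dots> \<longleftrightarrow> (\<exists>ys. list_all2 (\<lambda>g y. computes g (map s is) y) (g # gs) ys \<and> t = put b ys s)"
    unfolding rest list_all2_Cons1 by blast
  finally show ?case .
qed simp

lemma runs_Comp:
  assumes f: "runs f" and gs: "\<And>g. g \<in> set gs \<Longrightarrow> runs g"
  shows "runs (Comp f gs)"
  unfolding runs_def
proof (intro allI impI)
  fix "is" :: "nat list" and b s t
  assume below: "\<forall>i\<in>set is. i < b" and clean: "\<forall>j\<ge>b. s j = (0::nat)"
  define n where "n = length gs"
  have 1: "sem (arg_prog (map compile gs) is (Suc b)) s u \<longleftrightarrow>
      (\<exists>ys. list_all2 (\<lambda>g y. computes g (map s is) y) gs ys \<and> u = put (Suc b) ys s)" for u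
    by (rule sem_arg_prog) (use gs below clean in auto)
  have 2: "sem (compile f [Suc b..<Suc b + n] (Suc b + n)) (put (Suc b) ys s) u \<longleftrightarrow>
      (\<exists>y. computes f ys y \<and> u = (put (Suc b) ys s)(Suc b + n := y))"
    if "length ys = n" for u ys
  proof -
    have "map (put (Suc b) ys s) [Suc b..<Suc b + n] = ys"
      by (rule nth_equalityI) (auto simp: put_apply that simp del: upt_Suc)
    then show ?thesis
      using runsD[OF f, of "[Suc b..<Suc b + n]" "Suc b + n" "put (Suc b) ys s"] clean that
      by (auto simp: put_apply simp del: upt_Suc)
  qed
  have 3: "sem (Seq (clears n (Suc b)) (move (Suc b + n) b)) ((put (Suc b) ys s)(Suc b + n := y)) u
      \<longleftrightarrow> u = s(b := y)"
    if "length ys = n" for u ys y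
    using that clean by (simp add: relcompp_apply sem_clears sem_move) (auto simp: fun_eq_iff put_apply)
  show "sem (compile (Comp f gs) is b) s t \<longleftrightarrow> (\<exists>y. computes (Comp f gs) (map s is) y \<and> t = s(b := y))"
    (is "?L \<longleftrightarrow> ?R")
  proof
    assume ?L
    then obtain u v where u: "sem (arg_prog (map compile gs) is (Suc b)) s u"
      and v: "sem (compile f [Suc b..<Suc b + n] (Suc b + n)) u v"
      and t: "sem (Seq (clears n (Suc b)) (move (Suc b + n) b)) v t"
      by (simp only: compile.simps Let_def n_def[symmetric] sem.simps relcompp_apply) blast
    from u obtain ys where ys: "list_all2 (\<lambda>g y. computes g (map s is) y) gs ys"
      "u = put (Suc b) ys s" unfolding 1 by blast
    then have len: "length ys = n" by (simp add: list_all2_lengthD n_def)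
    from v ys obtain y where y: "computes f ys y" "v = (put (Suc b) ys s)(Suc b + n := y)"
      unfolding ys(2) 2[OF len] by blast
    with t have "t = s(b := y)"
      using 3[OF len] by blast
    moreover have "computes (Comp f gs) (map s is) y"
      using ys y by (auto simp: list_all2_conv_all_nth intro!: computes.Comp)
    ultimately show ?R by blast
  next
    assume ?R
    then obtain y ys where y: "t = s(b := y)" "computes f ys y" "length ys = n"
      "list_all2 (\<lambda>g y. computes g (map s is) y) gs ys"
      by (auto simp: computes_Comp list_all2_conv_all_nth n_def)
    then show ?L
      by (simp only: compile.simps Let_def n_def[symmetric] sem.simps(2)[of "arg_prog _ _ _"]
          sem.simps(2)[of "compile _ _ _"] relcompp_apply 1) (use y 2 3 in blast)
  qed
qed

text \<open>Primitive recursion unfolds downwards from \<open>n\<close>, whereas the compiled loop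
  counts upwards. A value at \<open>n\<close> is built on values at all smaller arguments, so the
  loop cannot get stuck on the way.\<close>

lemma computes_PrimRec_le:
  "computes (PrimRec f g) (n # xs) y \<Longrightarrow> k \<le> n \<Longrightarrow> \<exists>v. computes (PrimRec f g) (k # xs) v"
proof (induction n arbitrary: y)
  case (Suc n)
  then show ?case
    by (cases "k = Suc n") (auto simp: computes_PrimRec_suc)
qed auto

lemma runs_PrimRec:
  assumes f: "runs f" and g: "runs g"
  shows "runs (PrimRec f g)"
  unfolding runs_def
proof (intro allI impI)
  fix "is" :: "nat list" and b s t
  assume below: "\<forall>i\<in>set is. i < b" and clean: "\<forall>j\<ge>b. s j = (0::nat)"
  show "sem (compile (PrimRec f g) is b) s t \<longleftrightarrow>
      (\<exists>y. computes (PrimRec f g) (map s is) y \<and> t = s(b := y))"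
  proof (cases "is")
    case Nil
    then show ?thesis by (simp add: not_sem_abort computes_PrimRec_Nil)
  next
    case (Cons a js)
    define body where "body = Seq (compile g (b # (b + 2) # js) (b + 3))
      (Seq (clear b) (Seq (move (b + 3) b) (Act (Inc (b + 2)))))"
    \<comment> \<open>Register \<open>b\<close> holds the value \<open>v\<close> of the recursion at
      index \<open>i\<close>, \<open>b + 1\<close> the number \<open>m\<close> of passes still to be
      made, and \<open>b + 2\<close> the index \<open>i\<close>.\<close>
    define st where "st m i v = s(b := v, b + 1 := m, b + 2 := i)" for m i v
    define xs where "xs = map s js"
    have a: "a < b" and js: "\<And>j. j \<in> set js \<Longrightarrow> j < b" using below Cons by auto
    have map_js: "map (st m i v) js = xs" for m i v
      unfolding xs_def st_def by (rule map_cong) (auto dest: js)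
    have body: "sem body (st m i v) u \<longleftrightarrow> (\<exists>y. computes g (v # i # xs) y \<and> u = st m (Suc i) y)"
      for m i v u
    proof -
      have args: "map (st m i v) (b # (b + 2) # js) = v # i # xs"
        by (simp add: map_js) (simp add: st_def)
      have "sem (compile g (b # (b + 2) # js) (b + 3)) (st m i v) w \<longleftrightarrow>
          (\<exists>y. computes g (v # i # xs) y \<and> w = (st m i v)(b + 3 := y))" for w
        unfolding args[symmetric] by (rule runsD[OF g]) (use clean in \<open>auto simp: st_def dest: js\<close>)
      moreover have "sem (Seq (clear b) (Seq (move (b + 3) b) (Act (Inc (b + 2)))))
          ((st m i v)(b + 3 := y)) u \<longleftrightarrow> u = st m (Suc i) y" for y
        using clean by (simp add: relcompp_apply sem_clear sem_move) (auto simp: fun_eq_iff st_def)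
      ultimately show ?thesis
        unfolding body_def by (simp only: sem.simps(2)[of "compile _ _ _"] relcompp_apply) blast
    qed
    \<comment> \<open>The loop invariant: \<open>v\<close> is the value at \<open>i\<close>, and
      \<open>m + i\<close> stays equal to the recursion argument.\<close>
    have loop: "sem (drain (b + 1) body) (st m i v) u \<longleftrightarrow>
        (\<exists>y. computes (PrimRec f g) ((m + i) # xs) y \<and> u = st 0 (m + i) y)"
      if "computes (PrimRec f g) (i # xs) v" for m i v u
      using that
    proof (induction m arbitrary: i v)
      case 0
      have "st 0 i v (b + 1) = 0" by (simp add: st_def)
      with 0 show ?case
        by (subst sem_drain) (auto dest: computes_deterministic)
    next
      case (Suc m)
      have nz: "st (Suc m) i v (b + 1) = Suc m" and
        dec: "(st (Suc m) i v)(b + 1 := m) = st m i v"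
        by (auto simp: st_def fun_eq_iff)
      have "sem (drain (b + 1) body) (st (Suc m) i v) u \<longleftrightarrow>
          (\<exists>y. computes g (v # i # xs) y \<and> sem (drain (b + 1) body) (st m (Suc i) y) u)"
        unfolding sem_drain[of "b + 1" body "st (Suc m) i v"] nz diff_Suc_1 dec body by auto
      also have "\<dots> \<longleftrightarrow> (\<exists>y. computes g (v # i # xs) y \<and>
          (\<exists>z. computes (PrimRec f g) ((m + Suc i) # xs) z \<and> u = st 0 (m + Suc i) z))"
        using Suc.IH Suc.prems computes.PrimRec_Suc by blast
      \<comment> \<open>From right to left, a value at \<open>m + Suc i\<close> yields one at
        \<open>Suc i\<close>; by determinism its last step starts from the same
        \<open>v\<close>.\<close>
      also have "\<dots> \<longleftrightarrow> (\<exists>z. computes (PrimRec f g) ((m + Suc i) # xs) z \<and> u = st 0 (m + Suc i) z)"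
        using computes_PrimRec_le[of f g "m + Suc i" xs _ "Suc i"] Suc.prems
        by (auto simp: computes_PrimRec_suc) (metis computes_deterministic)
      finally show ?case by simp
    qed
    have 1: "sem (copy a (b + 1)) s u \<longleftrightarrow> u = s(b + 1 := s a)" for u
      using a clean by (subst sem_copy) auto
    have 2: "sem (compile f js (b + 3)) (s(b + 1 := s a)) u \<longleftrightarrow>
        (\<exists>y. computes f xs y \<and> u = s(b + 1 := s a, b + 3 := y))" for u
    proof -
      have "map (s(b + 1 := s a)) js = xs"
        unfolding xs_def by (rule map_cong) (auto dest: js)
      then show ?thesis
        by (subst runsD[OF f]) (use clean in \<open>auto dest: js\<close>)
    qed
    have 3: "sem (move (b + 3) b) (s(b + 1 := s a, b + 3 := y)) u \<longleftrightarrow> u = st (s a) 0 y" for y u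
      using clean by (subst sem_move) (auto simp: fun_eq_iff st_def)
    have 4: "sem (clear (b + 2)) (st 0 i y) u \<longleftrightarrow> u = s(b := y)" for i y u
      using clean by (auto simp: sem_clear st_def fun_eq_iff)
    have "sem (compile (PrimRec f g) is b) s t \<longleftrightarrow>
        (\<exists>v. computes f xs v \<and> (\<exists>u. sem (drain (b + 1) body) (st (s a) 0 v) u \<and>
          sem (clear (b + 2)) u t))"
      unfolding Cons compile.simps list.case body_def[symmetric] sem.simps(2) relcompp_apply 1 simp_thms 2
      using 3 by (metis (no_types, lifting))
    also have "\<dots> \<longleftrightarrow> (\<exists>v. computes f xs v \<and>
        (\<exists>y. computes (PrimRec f g) (s a # xs) y \<and> t = s(b := y)))"
    proof (intro ex_cong1 conj_cong refl)
      fix v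
      assume "computes f xs v"
      then have "sem (drain (b + 1) body) (st (s a) 0 v) u \<longleftrightarrow>
          (\<exists>y. computes (PrimRec f g) (s a # xs) y \<and> u = st 0 (s a) y)" for u
        using loop[of 0 v "s a" u] by (simp add: computes.PrimRec_0)
      then show "(\<exists>u. sem (drain (b + 1) body) (st (s a) 0 v) u \<and> sem (clear (b + 2)) u t) \<longleftrightarrow>
          (\<exists>y. computes (PrimRec f g) (s a # xs) y \<and> t = s(b := y))"
        using 4 by (metis (no_types, lifting))
    qed
    also have "\<dots> \<longleftrightarrow> (\<exists>y. computes (PrimRec f g) (s a # xs) y \<and> t = s(b := y))"
      using computes_PrimRec_le[of f g "s a" xs _ 0] by (auto simp: computes_PrimRec_zero)
    finally show ?thesis by (simp add: Cons xs_def)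
  qed
qed

text \<open>Each pass overwrites the guard register with the next value of \<open>f\<close>, so the
  number of passes is not known in advance. One direction is by induction along the iteration, the
  other by induction on the candidate.\<close>

lemma runs_Mu:
  assumes f: "runs f"
  shows "runs (Mu f)"
  unfolding runs_def
proof (intro allI impI)
  fix "is" :: "nat list" and b s t
  assume below: "\<forall>i\<in>set is. i < b" and clean: "\<forall>j\<ge>b. s j = (0::nat)"
  define F where "F = compile f (b # is) (b + 1)"
  define body where "body = Seq (clear (b + 1)) (Seq (Act (Inc b)) F)"
  \<comment> \<open>Register \<open>b\<close> holds the candidate \<open>m\<close>, and
    \<open>b + 1\<close> the value of \<open>f\<close> there.\<close>
  define st where "st m v = s(b := m, b + 1 := v)" for m v
  define xs where "xs = map s is"
  have map_is: "map (st m v) is = xs" for m v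
    unfolding xs_def st_def by (rule map_cong) (use below in auto)
  have F: "sem F (st m 0) u \<longleftrightarrow> (\<exists>y. computes f (m # xs) y \<and> u = st m y)" for m u
  proof -
    have "(st m 0)(b + 1 := y) = st m y" for y by (simp add: st_def)
    moreover have "map (st m 0) (b # is) = m # xs" by (simp add: map_is) (simp add: st_def)
    ultimately show ?thesis
      unfolding F_def using below clean
      by (subst runsD[OF f]) (auto simp: st_def)
  qed
  have reset: "(st m v)(b + 1 := 0) = st m 0" "(st m 0)(b := Suc (st m 0 b)) = st (Suc m) 0" for m v
    by (auto simp: st_def fun_eq_iff)
  have body: "sem body (st m v) u \<longleftrightarrow> (\<exists>y. computes f (Suc m # xs) y \<and> u = st (Suc m) y)"
    for m v u
    unfolding body_def by (simp add: relcompp_apply sem_clear F reset[simplified])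
  have iter: "sem (Seq (Act (Dec (b + 1))) body) (st m v) u \<longleftrightarrow>
      0 < v \<and> (\<exists>y. computes f (Suc m # xs) y \<and> u = st (Suc m) y)" for m v u
  proof -
    have "(st m v) (b + 1) = v" "(st m v)(b + 1 := v - 1) = st m (v - 1)" by (auto simp: st_def)
    then show ?thesis using body by (simp add: relcompp_apply)
  qed
  have s: "s = st 0 0" using clean by (simp add: st_def fun_eq_iff)
  have Mu: "sem (compile (Mu f) is b) s t \<longleftrightarrow> (\<exists>v u. computes f (0 # xs) v \<and>
      (sem (Seq (Act (Dec (b + 1))) body))\<^sup>*\<^sup>* (st 0 v) u \<and> u (b + 1) = 0 \<and> t = u)"
    unfolding compile.simps F_def[symmetric] body_def[symmetric]
    by (subst s) (auto simp: drain_def relcompp_apply F simp del: sem.simps(2) simp: sem.simps(2)[of F] sem.simps(2)[of "Star _"])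
  show "sem (compile (Mu f) is b) s t \<longleftrightarrow> (\<exists>y. computes (Mu f) (map s is) y \<and> t = s(b := y))"
    unfolding xs_def[symmetric]
  proof
    assume "sem (compile (Mu f) is b) s t"
    then obtain v where v: "computes f (0 # xs) v"
      and loop: "(sem (Seq (Act (Dec (b + 1))) body))\<^sup>*\<^sup>* (st 0 v) t" and z: "t (b + 1) = 0"
      unfolding Mu by blast
    \<comment> \<open>The invariant: all candidates already passed have positive values, which is
      what the guard \<open>Dec\<close> tested.\<close>
    from loop have "\<exists>m y. t = st m y \<and> computes f (m # xs) y \<and>
        (\<forall>j<m. \<exists>z. computes f (j # xs) (Suc z))"
    proof induction
      case base
      then show ?case using v by blast
    next
      case (step t u)
      then obtain m y where *: "t = st m y" "computes f (m # xs) y"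
        "\<forall>j<m. \<exists>z. computes f (j # xs) (Suc z)" by blast
      with step(2) iter[of m y u] obtain y' where
        "0 < y" "computes f (Suc m # xs) y'" "u = st (Suc m) y'" by blast
      moreover from \<open>0 < y\<close> * have "\<exists>z. computes f (m # xs) (Suc z)"
        by (metis Suc_pred)
      ultimately show ?case
        using * by (intro exI[of _ "Suc m"] exI[of _ y']) (auto simp: less_Suc_eq)
    qed
    then obtain m y where *: "t = st m y" "computes f (m # xs) y"
      "\<forall>j<m. \<exists>z. computes f (j # xs) (Suc z)" by blast
    with z have "y = 0" by (simp add: st_def)
    with * have "computes (Mu f) xs m" by (auto intro: computes.Mu)
    moreover have "t = s(b := m)"
      using * \<open>y = 0\<close> clean by (auto simp: st_def fun_eq_iff)
    ultimately show "\<exists>y. computes (Mu f) xs y \<and> t = s(b := y)" by blast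
  next
    assume "\<exists>y. computes (Mu f) xs y \<and> t = s(b := y)"
    then obtain n where n: "computes f (n # xs) 0" "\<And>m. m < n \<Longrightarrow> \<exists>y. computes f (m # xs) (Suc y)"
      "t = s(b := n)" by (auto simp: computes_Mu)
    then have "\<exists>v. computes f (0 # xs) v" by (cases n) auto
    then obtain v where v: "computes f (0 # xs) v" by blast
    have "(sem (Seq (Act (Dec (b + 1))) body))\<^sup>*\<^sup>* (st 0 v) (st m y)"
      if "m \<le> n" "computes f (m # xs) y" for m y
      using that
    proof (induction m arbitrary: y)
      case 0
      with v show ?case using computes_deterministic by blast
    next
      case (Suc m)
      with n(2)[of m] obtain z where "computes f (m # xs) (Suc z)" by auto
      with Suc show ?case
        by (metis Suc_leD iter rtranclp.rtrancl_into_rtrancl zero_less_Suc)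
    qed
    from this[of n 0] n have "(sem (Seq (Act (Dec (b + 1))) body))\<^sup>*\<^sup>* (st 0 v) (st n 0)" by simp
    moreover have "t = st n 0" using n(3) clean by (auto simp: st_def fun_eq_iff)
    ultimately show "sem (compile (Mu f) is b) s t"
      unfolding Mu using v by (auto simp: st_def)
  qed
qed

lemma runs: "runs f"
proof (induction f)
  case Zero
  show ?case by (auto simp: runs_def computes_Zero fun_eq_iff)
next
  case Succ
  show ?case
    unfolding runs_def
    by (auto simp: not_sem_abort computes_Succ sem_copy relcompp_apply split: list.split)
next
  case (Proj i)
  show ?case
    by (auto simp: runs_def not_sem_abort computes_Proj sem_copy)
qed (auto intro: runs_Comp runs_PrimRec runs_Mu)

section \<open>Runs as words with linear constraints\<close>

type_synonym edge = "nat \<times> act \<times> nat"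

section \<open>Flow graphs of programs\<close>

primrec psize :: "prog \<Rightarrow> nat" where
  "psize (Act a) = 1"
| "psize (Seq P Q) = psize P + psize Q"
| "psize (Star P) = psize P + 2"

text \<open>The graph of \<open>P\<close> has the nodes from the entry \<open>p\<close> to the exit
  \<open>p + psize P\<close>. In a sequence the exit of the first part is the entry of the second;
  \<open>Star\<close> adds a loop head before the body and an exit after it.\<close>

primrec edges :: "prog \<Rightarrow> nat \<Rightarrow> edge list" where
  "edges (Act a) p = [(p, a, Suc p)]"
| "edges (Seq P Q) p = edges P p @ edges Q (p + psize P)"
| "edges (Star P) p =
     (p, Skip, Suc p) # (p, Skip, p + psize P + 2) # (Suc p + psize P, Skip, p) # edges P (Suc p)"

definition estep :: "edge \<Rightarrow> nat \<times> (nat \<Rightarrow> nat) \<Rightarrow> nat \<times> (nat \<Rightarrow> nat) \<Rightarrow> bool" where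
  "estep e c d \<longleftrightarrow> fst c = fst e \<and> fst d = snd (snd e) \<and> step (fst (snd e)) (snd c) (snd d)"

primrec exec :: "edge list \<Rightarrow> nat \<times> (nat \<Rightarrow> nat) \<Rightarrow> nat \<times> (nat \<Rightarrow> nat) \<Rightarrow> bool" where
  "exec [] c d \<longleftrightarrow> d = c"
| "exec (e # es) c d \<longleftrightarrow> (\<exists>u. estep e c u \<and> exec es u d)"

lemma exec_append: "exec (es @ fs) c d \<longleftrightarrow> (\<exists>u. exec es c u \<and> exec fs u d)"
  by (induction es arbitrary: c) auto

text \<open>\<open>inside P p s q u\<close>: a run that enters the graph of \<open>P\<close> at its entry \<open>p\<close> with store \<open>s\<close>
  may be at node \<open>q\<close> with store \<open>u\<close>.\<close>

primrec inside :: "prog \<Rightarrow> nat \<Rightarrow> (nat \<Rightarrow> nat) \<Rightarrow> nat \<Rightarrow> (nat \<Rightarrow> nat) \<Rightarrow> bool" where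
  "inside (Act a) p s q u \<longleftrightarrow> q = p \<and> u = s \<or> q = Suc p \<and> step a s u"
| "inside (Seq P Q) p s q u \<longleftrightarrow> q < p + psize P \<and> inside P p s q u \<or>
     (\<exists>v. sem P s v \<and> inside Q (p + psize P) v q u)"
| "inside (Star P) p s q u \<longleftrightarrow> (\<exists>v. (sem P)\<^sup>*\<^sup>* s v \<and>
     ((q = p \<or> q = p + psize P + 2) \<and> u = v \<or> inside P (Suc p) v q u))"

lemma psize_pos: "0 < psize P"
  by (induction P) auto

text \<open>The strict bound on the source says that no edge of \<open>P\<close> leaves its exit.
  Hence a run that has reached the second part of a sequence cannot return to the first.\<close>

lemma edges_range:
  "(q, a, q') \<in> set (edges P p) \<Longrightarrow> p \<le> q \<and> q < p + psize P \<and> p \<le> q' \<and> q' \<le> p + psize P"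
  by (induction P arbitrary: p) (fastforce)+

lemma inside_range: "inside P p s q u \<Longrightarrow> p \<le> q \<and> q \<le> p + psize P"
  by (induction P arbitrary: p s) fastforce+

lemma inside_entry: "inside P p s p s"
  by (induction P arbitrary: p s) (auto simp: psize_pos)

text \<open>For a sequence the exit excludes the alternative with the strict bound. For
  \<open>Star\<close>, the graph of the body ends one node before the exit.\<close>

lemma inside_exit: "inside P p s (p + psize P) u \<Longrightarrow> sem P s u"
proof (induction P arbitrary: p s)
  case (Seq P Q)
  then show ?case by (auto simp: relcompp_apply add.assoc[symmetric])
next
  case (Star P)
  then show ?case by (auto dest: inside_range)
qed auto

text \<open>This makes \<open>inside\<close> an invariant of runs; with \<open>inside_exit\<close>
  it shows that a run from entry to exit is an execution of the program.\<close>

lemma inside_estep: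
  assumes "inside P p s q u" "(q, a, q') \<in> set (edges P p)" "step a u u'"
  shows "inside P p s q' u'"
  using assms
proof (induction P arbitrary: p s)
  case (Seq P Q)
  consider (P) "(q, a, q') \<in> set (edges P p)" | (Q) "(q, a, q') \<in> set (edges Q (p + psize P))"
    using Seq.prems(2) by auto
  then show ?case
  proof cases
    case P
    from edges_range[OF P] Seq.prems(1) have "inside P p s q u"
      by (auto dest: inside_range)
    then have *: "inside P p s q' u'" using Seq.IH(1) P Seq.prems(3) by blast
    show ?thesis
    proof (cases "q' = p + psize P")
      case True
      \<comment> \<open>At the shared node, the finished run of \<open>P\<close> becomes the start
        of a run at the entry of \<open>Q\<close>.\<close>
      with * have "sem P s u'" using inside_exit by blast
      with True show ?thesis using inside_entry by auto
    next
      case False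
      with edges_range[OF P] * show ?thesis by auto
    qed
  next
    case Q
    from edges_range[OF Q] Seq.prems(1) obtain v where "sem P s v" "inside Q (p + psize P) v q u"
      by auto
    with Seq.IH(2) Q Seq.prems(3) show ?thesis by auto
  qed
next
  case (Star P)
  from Star.prems(1) obtain v where v: "(sem P)\<^sup>*\<^sup>* s v"
    "(q = p \<or> q = p + psize P + 2) \<and> u = v \<or> inside P (Suc p) v q u" by auto
  from Star.prems(2) consider "q = p" "a = Skip" "q' = Suc p" | "q = p" "a = Skip" "q' = p + psize P + 2"
    | "q = Suc p + psize P" "a = Skip" "q' = p" | "(q, a, q') \<in> set (edges P (Suc p))" by auto
  then show ?case
  proof cases
    case 1
    with v Star.prems(3) inside_entry[of P "Suc p" v] show ?thesis by (auto dest: inside_range)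
  next
    case 2
    with v Star.prems(3) show ?thesis by (auto dest: inside_range)
  next
    case 3
    with v have "inside P (Suc p) v (Suc p + psize P) u" by auto
    then have "sem P v u" by (rule inside_exit)
    with v(1) have "(sem P)\<^sup>*\<^sup>* s u" by simp
    with 3 Star.prems(3) show ?thesis by auto
  next
    case 4
    with edges_range[OF 4] v have "inside P (Suc p) v q u" by auto
    with Star.IH 4 Star.prems(3) v(1) show ?thesis by auto
  qed
qed auto

lemma sem_imp_exec:
  "sem P s t \<Longrightarrow> \<exists>es. set es \<subseteq> set (edges P p) \<and> exec es (p, s) (p + psize P, t)"
proof (induction P arbitrary: p s t)
  case (Act a)
  then show ?case by (intro exI[of _ "[(p, a, Suc p)]"]) (simp add: estep_def)
next
  case (Seq P Q)
  from Seq.prems obtain u where "sem P s u" "sem Q u t" by auto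
  from Seq.IH(1)[OF this(1), of p] Seq.IH(2)[OF this(2), of "p + psize P"] obtain es fs
    where "set es \<subseteq> set (edges P p)" "exec es (p, s) (p + psize P, u)"
      "set fs \<subseteq> set (edges Q (p + psize P))" "exec fs (p + psize P, u) (p + psize P + psize Q, t)"
    by blast
  then show ?case
    by (intro exI[of _ "es @ fs"]) (auto simp: exec_append add.assoc)
next
  case (Star P)
  have "(sem P)\<^sup>*\<^sup>* s u \<Longrightarrow> \<exists>es. set es \<subseteq> set (edges (Star P) p) \<and> exec es (p, s) (p, u)" for u
  proof (induction rule: rtranclp_induct)
    case base
    show ?case by (rule exI[of _ "[]"]) simp
  next
    case (step u v)
    from step.IH obtain es where es: "set es \<subseteq> set (edges (Star P) p)" "exec es (p, s) (p, u)"
      by blast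
    from Star.IH[OF step.hyps(2), of "Suc p"] obtain fs
      where fs: "set fs \<subseteq> set (edges P (Suc p))" "exec fs (Suc p, u) (Suc p + psize P, v)" by blast
    have "exec ((p, Skip, Suc p) # fs @ [(Suc p + psize P, Skip, p)]) (p, u) (p, v)"
      using fs(2) by (fastforce simp: estep_def exec_append)
    with es fs(1) show ?case
      by (intro exI[of _ "es @ (p, Skip, Suc p) # fs @ [(Suc p + psize P, Skip, p)]"])
        (auto simp: exec_append simp del: exec.simps)
  qed
  with Star.prems obtain es where "set es \<subseteq> set (edges (Star P) p)" "exec es (p, s) (p, t)" by auto
  then show ?case
    by (intro exI[of _ "es @ [(p, Skip, p + psize (Star P))]"])
      (auto simp: exec_append estep_def)
qed

section \<open>Runs described by sums over edges\<close>

text \<open>Along a run from node \<open>0\<close> with the empty store, the current node and the contents of every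
  register are sums over the edges used so far.\<close>

definition jump :: "edge \<Rightarrow> int" where
  "jump e = int (snd (snd e)) - int (fst e)"

definition delta :: "nat \<Rightarrow> edge \<Rightarrow> int" where
  "delta r e = (if fst (snd e) = Inc r then 1 else if fst (snd e) = Dec r then -1 else 0)"

text \<open>Here \<open>es\<close> is meant to end with \<open>e\<close>, so the sums are those
  after the step. The jumps add up to the target of \<open>e\<close> iff the node before was its
  source, and a decrement was possible iff the sum is still non-negative.\<close>

definition edge_ok :: "edge list \<Rightarrow> edge \<Rightarrow> bool" where
  "edge_ok es e \<longleftrightarrow> sum_list (map jump es) = int (snd (snd e)) \<and>
     (\<forall>r. fst (snd e) = Dec r \<longrightarrow> 0 \<le> sum_list (map (delta r) es)) \<and>
     (\<forall>r. fst (snd e) = Tst r \<longrightarrow> sum_list (map (delta r) es) \<le> 0)"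

text \<open>Only a \<open>Dec\<close> edge can lower the sum, and there the sign is checked.\<close>

lemma edge_ok_nonneg:
  "\<forall>m<length es. edge_ok (take (Suc m) es) (es ! m) \<Longrightarrow> 0 \<le> sum_list (map (delta r) es)"
proof (induction es rule: rev_induct)
  case (snoc e es)
  from snoc.prems have "\<forall>m<length es. edge_ok (take (Suc m) es) (es ! m)" "edge_ok (es @ [e]) e"
    by (auto simp: less_Suc_eq nth_append)
  moreover have "fst (snd e) = Dec r \<Longrightarrow> 0 \<le> sum_list (map (delta r) (es @ [e]))"
    using \<open>edge_ok (es @ [e]) e\<close> by (simp add: edge_ok_def)
  ultimately show ?case
    using snoc.IH by (cases "fst (snd e) = Dec r") (auto simp: delta_def[of r e])
qed simp

lemma exec_iff_sums:
  "exec es (0, \<lambda>_. 0) (q, t) \<longleftrightarrow>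
     (\<forall>m<length es. edge_ok (take (Suc m) es) (es ! m)) \<and>
     int q = sum_list (map jump es) \<and> (\<forall>r. int (t r) = sum_list (map (delta r) es))"
proof (induction es arbitrary: q t rule: rev_induct)
  case Nil
  then show ?case by (auto simp: fun_eq_iff)
next
  case (snoc e es)
  obtain p a p' where e: "e = (p, a, p')" by (cases e)
  define A where "A \<longleftrightarrow> (\<forall>m<length es. edge_ok (take (Suc m) es) (es ! m))"
  have A: "(\<forall>m<length (es @ [e]). edge_ok (take (Suc m) (es @ [e])) ((es @ [e]) ! m)) \<longleftrightarrow>
      A \<and> edge_ok (es @ [e]) e"
    by (auto simp: A_def less_Suc_eq nth_append)
  have "exec (es @ [e]) (0, \<lambda>_. 0) (q, t) \<longleftrightarrow> q = p' \<and> (\<exists>u. A \<and> int p = sum_list (map jump es) \<and>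
      (\<forall>r. int (u r) = sum_list (map (delta r) es)) \<and> step a u t)"
    by (auto simp: exec_append snoc estep_def e A_def)
  also have "\<dots> \<longleftrightarrow> A \<and> edge_ok (es @ [e]) e \<and> int q = sum_list (map jump (es @ [e])) \<and>
      (\<forall>r. int (t r) = sum_list (map (delta r) (es @ [e])))" (is "?L \<longleftrightarrow> ?R")
  proof
    assume ?L
    then obtain u where u: "q = p'" A "int p = sum_list (map jump es)"
      "\<And>r. int (u r) = sum_list (map (delta r) es)" "step a u t" by blast
    then show ?R
      by (cases a) (auto simp: edge_ok_def e jump_def delta_def u(3,4)[symmetric] of_nat_diff)
  next
    assume R: ?R
    \<comment> \<open>The intermediate store is read off from the sums; \<open>nat\<close> loses
      nothing because they are non-negative.\<close>
    define u where "u r = nat (sum_list (map (delta r) es))" for r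
    have u: "int (u r) = sum_list (map (delta r) es)" for r
      using R edge_ok_nonneg[of es r] by (simp add: u_def A_def)
    have t: "int (t r) = int (u r) + delta r e" for r
      using R by (simp add: u)
    have "step a u t"
    proof (cases a)
      case Skip
      then show ?thesis using t by (auto simp: delta_def e fun_eq_iff)
    next
      case (Inc x)
      then have "int (t r) = int (u r) + (if r = x then 1 else 0)" for r
        using t[of r] by (auto simp: delta_def e)
      then have "t r = u r + (if r = x then 1 else 0)" for r
        by (metis (mono_tags, opaque_lifting) of_nat_0 of_nat_1 of_nat_add of_nat_eq_iff)
      with Inc show ?thesis by (auto simp: fun_eq_iff)
    next
      case (Dec x)
      then have "int (t r) = int (u r) - (if r = x then 1 else 0)" for r
        using t[of r] by (auto simp: delta_def e)
      then have "u r = t r + (if r = x then 1 else 0)" for r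
        by (smt (verit) of_nat_0 of_nat_1 of_nat_add of_nat_eq_iff)
      with Dec show ?thesis by (auto simp: fun_eq_iff)
    next
      case (Tst x)
      then have "int (u x) \<le> 0" using R u[of x] by (simp add: edge_ok_def e delta_def)
      with Tst t show ?thesis by (auto simp: delta_def e fun_eq_iff)
    qed
    moreover have "int p = sum_list (map jump es)" "int q = int p'"
      using R by (simp_all add: edge_ok_def e jump_def)
    ultimately show ?L using u R by auto
  qed
  finally show ?case unfolding A by blast
qed

lemma exec_ex_iff:
  "(\<exists>c. exec es (0, \<lambda>_. 0) c) \<longleftrightarrow> (\<forall>m<length es. edge_ok (take (Suc m) es) (es ! m))"
proof
  assume ok: "\<forall>m<length es. edge_ok (take (Suc m) es) (es ! m)"
  \<comment> \<open>The sum of all jumps is the target of the last edge, hence a natural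
    number.\<close>
  then have "edge_ok es (last es)" if "es \<noteq> []"
    using that by (auto simp: last_conv_nth dest!: spec[of _ "length es - 1"])
  then have "0 \<le> sum_list (map jump es)"
    by (cases "es = []") (auto simp: edge_ok_def)
  then have "exec es (0, \<lambda>_. 0)
      (nat (sum_list (map jump es)), \<lambda>r. nat (sum_list (map (delta r) es)))"
    using ok edge_ok_nonneg[OF ok] by (simp add: exec_iff_sums)
  then show "\<exists>c. exec es (0, \<lambda>_. 0) c" by blast
qed (auto simp: exec_iff_sums)

section \<open>Words subject to counting constraints\<close>

type_synonym constr = "nat \<times> (nat \<Rightarrow> int) \<times> int"

definition count_lang :: "constr list \<Rightarrow> nat list \<Rightarrow> bool" where
  "count_lang G w \<longleftrightarrow> (\<forall>m<length w. \<forall>(j, a, b)\<in>set G. w ! m = j \<longrightarrow>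
     0 \<le> sum_list (map a (take (Suc m) w)) + b)"

text \<open>The occurrences of letter \<open>0\<close> load \<open>n\<close> into the input register.\<close>

definition halt_word :: "nat \<Rightarrow> constr list \<Rightarrow> nat \<Rightarrow> nat list \<Rightarrow> bool" where
  "halt_word k G n w \<longleftrightarrow> w \<noteq> [] \<and> set w \<subseteq> {..<k} \<and> last w = k - 1 \<and>
     (\<forall>m<length w. w ! m = 0 \<longleftrightarrow> m < n) \<and> count_lang G w"

definition edge_constraints :: "edge list \<Rightarrow> nat \<Rightarrow> constr list" where
  "edge_constraints E j = (let e = E ! j in
     [(j, \<lambda>i. jump (E ! i), - int (snd (snd e))), (j, \<lambda>i. - jump (E ! i), int (snd (snd e)))] @
     (case fst (snd e) of
        Dec r \<Rightarrow> [(j, \<lambda>i. delta r (E ! i), 0)]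
      | Tst r \<Rightarrow> [(j, \<lambda>i. - delta r (E ! i), 0)]
      | _ \<Rightarrow> []))"

lemma edge_constraints_fst: "c \<in> set (edge_constraints E j) \<Longrightarrow> fst c = j"
  by (auto simp: edge_constraints_def Let_def split: act.splits)

lemma sum_list_uminus: "sum_list (map (\<lambda>x. - f x) xs) = - sum_list (map f xs)" for f :: "'a \<Rightarrow> int"
  by (induction xs) auto

lemma count_lang_edge_constraints:
  assumes "set w \<subseteq> {..<length E}"
  shows "count_lang (concat (map (edge_constraints E) [0..<length E])) w \<longleftrightarrow>
    (let es = map ((!) E) w in \<forall>m<length es. edge_ok (take (Suc m) es) (es ! m))"
proof -
  have "(\<forall>(j, a, b)\<in>set (concat (map (edge_constraints E) [0..<length E])). w ! m = j \<longrightarrow>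
      0 \<le> sum_list (map a (take (Suc m) w)) + b) \<longleftrightarrow>
      edge_ok (take (Suc m) (map ((!) E) w)) (E ! (w ! m))" if "m < length w" for m
  proof -
    have "w ! m < length E" using assms that by (auto dest: nth_mem)
    then have "(\<forall>(j, a, b)\<in>set (concat (map (edge_constraints E) [0..<length E])). w ! m = j \<longrightarrow>
        0 \<le> sum_list (map a (take (Suc m) w)) + b) \<longleftrightarrow>
        (\<forall>(j, a, b)\<in>set (edge_constraints E (w ! m)). 0 \<le> sum_list (map a (take (Suc m) w)) + b)"
      unfolding split_beta set_concat set_map set_upt using edge_constraints_fst by fastforce
    also have "\<dots> \<longleftrightarrow> edge_ok (take (Suc m) (map ((!) E) w)) (E ! (w ! m))"
      by (auto simp: edge_constraints_def edge_ok_def Let_def take_map sum_list_uminus o_def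
          split: act.splits)
    finally show ?thesis .
  qed
  then show ?thesis by (simp add: count_lang_def)
qed

lemma exec_feed: "exec (replicate n (0, Inc 0, 0)) (0, s) c \<longleftrightarrow> c = (0, s(0 := s 0 + n))"
proof (induction n arbitrary: s)
  case (Suc n)
  have "estep (0, Inc 0, 0) (0, s) d \<longleftrightarrow> d = (0, s(0 := Suc (s 0)))" for d
    by (cases d) (auto simp: estep_def)
  then have "exec (replicate (Suc n) (0, Inc 0, 0)) (0, s) c \<longleftrightarrow>
      exec (replicate n (0, Inc 0, 0)) (0, s(0 := Suc (s 0))) c"
    by simp
  moreover have "(s(0 := Suc (s 0)))(0 := (s(0 := Suc (s 0))) 0 + n) = s(0 := s 0 + Suc n)"
    by (simp add: fun_eq_iff)
  ultimately show ?case
    unfolding Suc.IH by (simp only:)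
qed simp

lemma exec_inside:
  assumes "exec es c d" "set es \<subseteq> set (edges P p) \<union> {(p + psize P, Skip, p + psize P)}"
    "inside P p s (fst c) (snd c)"
  shows "inside P p s (fst d) (snd d)"
  using assms
proof (induction es arbitrary: c)
  case (Cons e es)
  then obtain u where u: "estep e c u" "exec es u d" by auto
  obtain q a q' where e: "e = (q, a, q')" by (cases e)
  have "inside P p s (fst u) (snd u)"
  proof (cases "e \<in> set (edges P p)")
    case True
    with u(1) Cons.prems(3) show ?thesis
      by (auto simp: e estep_def intro: inside_estep)
  next
    case False
    with Cons.prems u(1) show ?thesis by (auto simp: estep_def)
  qed
  with Cons u show ?case by auto
qed simp

theorem computes_iff_halt_word:
  "\<exists>k G. 0 < k \<and> (\<forall>(j, a, b)\<in>set G. j < k) \<and> (\<forall>n. (\<exists>y. computes h [n] y) \<longleftrightarrow> (\<exists>w. halt_word k G n w))"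
proof -
  define P where "P = compile h [0] 1"
  \<comment> \<open>A \<open>Skip\<close> loop at the exit turns halting into a condition on the
    last letter.\<close>
  define final where "final = (psize P, Skip, psize P)"
  \<comment> \<open>Edge number 0 is a loop at the entry that loads the input; \<open>final\<close>
    has the last number.\<close>
  define E where "E = (0, Inc 0, 0) # edges P 0 @ [final]"
  define G where "G = concat (map (edge_constraints E) [0..<length E])"
  have E: "E ! 0 = (0, Inc 0, 0)" "E ! (length E - 1) = final" "2 \<le> length E"
    by (simp_all add: E_def nth_append)
  have E_mem: "E ! j \<in> set (edges P 0) \<union> {final}" if "j < length E" "j \<noteq> 0" for j
    using that by (cases j) (auto simp: E_def nth_append less_Suc_eq)
  have exec: "count_lang G w \<longleftrightarrow> (\<exists>c. exec (map ((!) E) w) (0, \<lambda>_. 0) c)" if "set w \<subseteq> {..<length E}" for w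
    unfolding G_def exec_ex_iff by (simp add: count_lang_edge_constraints[OF that] Let_def)
  have sem: "(\<exists>t. sem P ((\<lambda>_. 0)(0 := n)) t) \<longleftrightarrow> (\<exists>y. computes h [n] y)" for n
    unfolding P_def by (subst runsD[OF runs]) auto
  have "(\<exists>y. computes h [n] y) \<longleftrightarrow> (\<exists>w. halt_word (length E) G n w)" for n
  proof
    assume "\<exists>y. computes h [n] y"
    then obtain t where "sem P ((\<lambda>_. 0)(0 := n)) t" using sem by blast
    from sem_imp_exec[OF this, of 0] obtain es where es: "set es \<subseteq> set (edges P 0)"
      "exec es (0, (\<lambda>_. 0)(0 := n)) (psize P, t)" by auto
    have "\<forall>e\<in>set es. \<exists>j. 0 < j \<and> j < length E \<and> E ! j = e"
    proof
      fix e assume "e \<in> set es"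
      with es(1) obtain i where "i < length (edges P 0)" "edges P 0 ! i = e"
        by (meson in_set_conv_nth subsetD)
      then show "\<exists>j. 0 < j \<and> j < length E \<and> E ! j = e"
        by (intro exI[of _ "Suc i"]) (simp add: E_def nth_append)
    qed
    then obtain idx where idx: "\<And>e. e \<in> set es \<Longrightarrow> 0 < idx e \<and> idx e < length E \<and> E ! idx e = e"
      by metis
    define v where "v = map idx es @ [length E - 1]"
    define w where "w = replicate n 0 @ v"
    have v: "i < length v \<Longrightarrow> 0 < v ! i \<and> v ! i < length E" for i
      using idx E(3) by (auto simp: v_def nth_append)
    have "map ((!) E) (map idx es) = es"
      using idx by (auto intro: map_idI)
    then have "map ((!) E) w = replicate n (0, Inc 0, 0) @ es @ [final]"
      using E by (simp add: w_def v_def)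
    moreover have "exec (replicate n (0, Inc 0, 0) @ es @ [final]) (0, \<lambda>_. 0) (psize P, t)"
      using es(2) by (auto simp: exec_append exec_feed estep_def final_def)
    moreover have "set w \<subseteq> {..<length E}"
      using E(3) v by (fastforce simp: w_def in_set_conv_nth)
    ultimately have "count_lang G w" using exec by auto
    moreover have "w ! m = 0 \<longleftrightarrow> m < n" if "m < length w" for m
      using that v[of "m - n"] by (auto simp: w_def nth_append)
    ultimately have "halt_word (length E) G n w"
      using \<open>set w \<subseteq> _\<close> by (auto simp: halt_word_def) (simp_all add: w_def v_def)
    then show "\<exists>w. halt_word (length E) G n w" by blast
  next
    assume "\<exists>w. halt_word (length E) G n w"
    then obtain w where w: "w \<noteq> []" "set w \<subseteq> {..<length E}" "last w = length E - 1"
      "\<And>m. m < length w \<Longrightarrow> w ! m = 0 \<longleftrightarrow> m < n" "count_lang G w"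
      by (auto simp: halt_word_def)
    then obtain c where c: "exec (map ((!) E) w) (0, \<lambda>_. 0) c" using exec by blast
    \<comment> \<open>A word of loading letters only would end in 0, but the last letter is
      \<open>length E - 1\<close>, which is positive.\<close>
    have "n < length w"
    proof (rule ccontr)
      assume "\<not> n < length w"
      with w(1) have "length w - 1 < n" by (cases w) auto
      then have "w ! (length w - 1) = 0" using w(1) w(4)[of "length w - 1"] by simp
      with w(1,3) E(3) show False by (simp add: last_conv_nth)
    qed
    then have split: "w = replicate n 0 @ drop n w"
      using w(4) by (intro nth_equalityI) (auto simp: nth_append)
    then have "map ((!) E) w = replicate n (0, Inc 0, 0) @ map ((!) E) (drop n w)"
      using E(1) by (metis map_append map_replicate)
    with c have ex: "exec (map ((!) E) (drop n w)) (0, (\<lambda>_. 0)(0 := n)) c"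
      by (auto simp: exec_append exec_feed)
    have "j < length E \<and> j \<noteq> 0" if "j \<in> set (drop n w)" for j
    proof
      show "j < length E" using that w(2) by (auto dest: in_set_dropD)
      from that obtain i where "i < length w - n" "j = w ! (n + i)"
        by (auto simp: in_set_conv_nth)
      with w(4)[of "n + i"] show "j \<noteq> 0" by simp
    qed
    with E_mem have "set (map ((!) E) (drop n w)) \<subseteq> set (edges P 0) \<union> {final}"
      by (simp only: set_map) blast
    then have ins: "inside P 0 ((\<lambda>_. 0)(0 := n)) (fst c) (snd c)"
      using exec_inside[OF ex, of P 0] inside_entry by (auto simp: final_def)
    obtain u where "drop n w = u @ [length E - 1]"
      using \<open>n < length w\<close> w(3) by (metis append_butlast_last_id drop_eq_Nil last_drop not_le)
    with ex E(2) have "exec (map ((!) E) u @ [final]) (0, (\<lambda>_. 0)(0 := n)) c" by simp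
    then have "fst c = psize P"
      by (auto simp: exec_append estep_def final_def)
    with ins have "sem P ((\<lambda>_. 0)(0 := n)) (snd c)"
      using inside_exit[of P 0] by simp
    with sem show "\<exists>y. computes h [n] y" by blast
  qed
  moreover have "\<forall>(j, a, b)\<in>set G. j < length E"
    by (auto simp: G_def dest: edge_constraints_fst)
  ultimately show ?thesis
    using E(3) by (intro exI[of _ "length E"] exI[of _ G]) auto
qed

section \<open>Transformer encoders recognising runs\<close>

declare vec_of_list_Cons [simp del] vec_of_list_Nil [simp del]

section \<open>Networks given by lists of affine functionals\<close>

text \<open>An affine functional is given by its coefficients and its constant term.\<close>

type_synonym row = "(nat \<Rightarrow> rat) \<times> rat"

definition lin :: "nat \<Rightarrow> row \<Rightarrow> real list \<Rightarrow> real" where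
  "lin c r x = (\<Sum>j<c. of_rat (fst r j) * x ! j) + of_rat (snd r)"

definition coord :: "nat \<Rightarrow> row" where
  "coord i = ((\<lambda>j. if j = i then 1 else 0), 0)"

definition const :: "rat \<Rightarrow> row" where
  "const q = ((\<lambda>_. 0), q)"

definition radd :: "row \<Rightarrow> row \<Rightarrow> row" where
  "radd r s = ((\<lambda>j. fst r j + fst s j), snd r + snd s)"

definition rscale :: "rat \<Rightarrow> row \<Rightarrow> row" where
  "rscale q r = ((\<lambda>j. q * fst r j), q * snd r)"

definition rsum :: "nat \<Rightarrow> (nat \<Rightarrow> row) \<Rightarrow> row" where
  "rsum n f = ((\<lambda>j. \<Sum>i<n. fst (f i) j), \<Sum>i<n. snd (f i))"

lemma lin_coord: "i < c \<Longrightarrow> lin c (coord i) x = x ! i"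
proof -
  assume "i < c"
  have "(\<Sum>j<c. of_rat (if j = i then 1 else 0) * x ! j) = (\<Sum>j<c. if j = i then x ! j else 0)"
    by (rule sum.cong) auto
  with \<open>i < c\<close> show ?thesis by (simp add: lin_def coord_def)
qed

lemma lin_const: "lin c (const q) x = of_rat q"
  by (simp add: lin_def const_def)

lemma lin_radd: "lin c (radd r s) x = lin c r x + lin c s x"
  by (simp add: lin_def radd_def of_rat_add algebra_simps sum.distrib)

lemma lin_rscale: "lin c (rscale q r) x = of_rat q * lin c r x"
  by (simp add: lin_def rscale_def of_rat_mult algebra_simps sum_distrib_left)

lemma lin_rsum: "lin c (rsum n f) x = (\<Sum>i<n. lin c (f i) x)"
  by (simp add: lin_def rsum_def of_rat_sum sum.distrib sum_distrib_right)
    (rule sum.swap)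

lemmas lin_simps = lin_coord lin_const lin_radd lin_rscale lin_rsum

definition row_mat :: "nat \<Rightarrow> row list \<Rightarrow> rat mat" where
  "row_mat c rs = mat (length rs) c (\<lambda>(i, j). fst (rs ! i) j)"

definition row_bias :: "row list \<Rightarrow> rat vec" where
  "row_bias rs = vec (length rs) (\<lambda>i. snd (rs ! i))"

lemma row_mat_carrier [simp]: "row_mat c rs \<in> carrier_mat r c' \<longleftrightarrow> length rs = r \<and> c = c'"
  "dim_row (row_mat c rs) = length rs" "dim_col (row_mat c rs) = c"
  by (auto simp: row_mat_def)

lemma row_bias_carrier [simp]: "row_bias rs \<in> carrier_vec (length rs)"
  by (simp add: row_bias_def)

lemma affine_rows:
  "length x = c \<Longrightarrow> affine (row_mat c rs) (row_bias rs) (vec_of_list x) =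
     vec_of_list (map (\<lambda>r. lin c r x) rs)"
  by (rule eq_vecI)
    (auto simp: affine_def row_mat_def row_bias_def lin_def scalar_prod_def vec_of_list_index
      lessThan_atLeast0 intro!: sum.cong)

lemma row_mat_mult:
  "length x = c \<Longrightarrow> real_mat (row_mat c rs) *\<^sub>v vec_of_list x =
     vec_of_list (map (\<lambda>r. lin c r x - of_rat (snd r)) rs)"
  by (rule eq_vecI)
    (auto simp: row_mat_def lin_def scalar_prod_def vec_of_list_index
      lessThan_atLeast0 intro!: sum.cong)

definition net1 :: "nat \<Rightarrow> row list \<Rightarrow> fnn" where
  "net1 c os = Output (row_mat c os) (row_bias os)"

text \<open>The hidden layer applies \<open>relu\<close> to every row, so a value that is merely
  passed on has to be non-negative, as are all such values below.\<close>

definition net2 :: "nat \<Rightarrow> row list \<Rightarrow> row list \<Rightarrow> fnn" where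
  "net2 c hs os = Hidden (row_mat c hs) (row_bias hs) (net1 (length hs) os)"

lemma fnn_eval_net1:
  "length x = c \<Longrightarrow> fnn_eval (net1 c os) (vec_of_list x) = vec_of_list (map (\<lambda>r. lin c r x) os)"
  by (simp add: net1_def affine_rows)

lemma map_vec_vec_of_list: "map_vec f (vec_of_list xs) = vec_of_list (map f xs)"
  by (rule eq_vecI) (auto simp: vec_of_list_index)

lemma fnn_eval_net2:
  "length x = c \<Longrightarrow> fnn_eval (net2 c hs os) (vec_of_list x) =
     vec_of_list (map (\<lambda>r. lin (length hs) r (map (\<lambda>h. relu (lin c h x)) hs)) os)"
  by (simp only: net2_def fnn_eval.simps affine_rows map_vec_vec_of_list map_map o_def)
    (rule fnn_eval_net1, simp)

lemma fnn_wf_net1 [simp]: "fnn_wf c n (net1 c os) \<longleftrightarrow> length os = n"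
  by (auto simp: net1_def)

lemma fnn_wf_net2 [simp]: "fnn_wf c n (net2 c hs os) \<longleftrightarrow> length os = n"
  by (auto simp: net2_def intro!: exI[of _ "length hs"])

lemma relu_simps: "0 \<le> x \<Longrightarrow> relu x = x" "x \<le> 0 \<Longrightarrow> relu x = 0" "0 \<le> relu x"
  "relu x = 0 \<longleftrightarrow> x \<le> 0"
  by (auto simp: relu_def)

section \<open>Attention heads as averages over positions\<close>

lemma layer_step_comb_only:
  "ul_heads l = [] \<Longrightarrow> layer_step (layer_of l) xs = map (fnn_eval (ul_comb l)) xs"
  by (simp add: layer_step_def layer_of_def vec_list)

lemma layer_step_one_head:
  "ul_heads l = [H] \<Longrightarrow> layer_step (layer_of l) xs =
     map (\<lambda>x. fnn_eval (ul_comb l)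
       (vec_of_list (list_of_vec x @ list_of_vec (attend (head_of H) xs x)))) xs"
  by (simp add: layer_step_def layer_of_def)

lemma hardmax_indicator:
  assumes "\<And>i. i < length ss \<Longrightarrow> (if i \<in> S then ss ! i = c else ss ! i < c)"
    and "S \<noteq> {}" "S \<subseteq> {..<length ss}" "i < length ss"
  shows "hardmax i ss = (if i \<in> S then 1 / card S else 0)"
proof (cases "i \<in> S")
  case True
  then have "ss ! i = c" using assms(1,4) by fastforce
  moreover have "\<forall>j<length ss. ss ! j \<le> c" using assms(1) by (metis less_eq_real_def)
  moreover have "{j. j < length ss \<and> ss ! j = c} = S"
  proof (intro equalityI subsetI)
    fix j
    assume "j \<in> {j. j < length ss \<and> ss ! j = c}"
    then show "j \<in> S" using assms(1)[of j] by (auto split: if_splits)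
  next
    fix j
    assume "j \<in> S"
    then show "j \<in> {j. j < length ss \<and> ss ! j = c}" using assms(1)[of j] assms(3) by auto
  qed
  ultimately show ?thesis using True by (simp add: hardmax_def)
next
  case False
  obtain j where "j \<in> S" using assms(2) by blast
  then have "j < length ss" "\<not> ss ! j \<le> ss ! i"
    using False assms(1)[of i] assms(1)[of j] assms(3,4) by auto
  with False show ?thesis by (auto simp: hardmax_def)
qed

lemma attend_average:
  assumes "\<And>i. i < length xs \<Longrightarrow>
      (if i \<in> S then head_score (head_of H) x (xs ! i) = c else head_score (head_of H) x (xs ! i) < c)"
    and "S \<noteq> {}" "S \<subseteq> {..<length xs}"
  shows "attend (head_of H) xs x = vec (dim_row (uh_matrix H))
    (\<lambda>r. (\<Sum>i\<in>S. (real_mat (uh_matrix H) *\<^sub>v (xs ! i)) $ r) / card S)"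
proof -
  have "(\<Sum>i<length xs. hardmax i (map (head_score (head_of H) x) xs) * f i) = (\<Sum>i\<in>S. f i) / card S" for f :: "nat \<Rightarrow> real"
  proof -
    have "(\<Sum>i<length xs. hardmax i (map (head_score (head_of H) x) xs) * f i) =
        (\<Sum>i<length xs. if i \<in> S then f i / card S else 0)"
      by (rule sum.cong[OF refl], subst hardmax_indicator[where S = S and c = c]) (use assms in auto)
    also have "\<dots> = (\<Sum>i\<in>S. f i / card S)"
      using assms(3) by (simp add: sum.inter_restrict[symmetric] Int_absorb1)
    finally show ?thesis by (simp add: sum_divide_distrib)
  qed
  then show ?thesis
    by (simp add: attend_def pool_def) (simp add: head_of_def)
qed

text \<open>The score \<open>- relu s\<close> has its maximum 0 exactly where \<open>s <= 0\<close>,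
  so \<open>hardmax\<close> becomes a uniform average over the positions that satisfy an
  inequality.\<close>

definition below_net :: fnn where
  "below_net = net2 1 [coord 0] [rscale (-1) (coord 0)]"

lemma fnn_scalar_below_net: "fnn_scalar below_net (vec_of_list [s]) = - relu s"
  by (simp add: fnn_scalar_def below_net_def fnn_eval_net2 lin_simps vec_of_list_index)

text \<open>At position \<open>x\<close> the difference of the last two rows after
  \<open>relu\<close> is the indicator of \<open>x <= n\<close>. The number \<open>n\<close> occurs
  in constant terms only, which keeps the code of the layer easy to compute from
  \<open>n\<close>.\<close>

definition input_hidden :: "nat \<Rightarrow> row list" where
  "input_hidden n = [coord 4, coord 2, const 1,
     radd (const (of_nat (Suc n))) (rscale (-1) (coord 2)),
     radd (const (of_nat n)) (rscale (-1) (coord 2))]"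

definition input_layer :: "nat \<Rightarrow> udec_layer" where
  "input_layer n = \<lparr> ul_heads = [],
     ul_comb = net2 5 (input_hidden n)
       [coord 0, coord 1, coord 2, radd (coord 3) (rscale (-1) (coord 4))] \<rparr>"

lemma input_layer:
  "layer_step (layer_of (input_layer n)) (embed_word (te_of P) w) =
     map (\<lambda>m. vec_of_list [real (w ! m), real (Suc m), 1, of_bool (m < n)]) [0..<length w]"
proof -
  have "fnn_eval (ul_comb (input_layer n)) (udec_emb a (Suc m)) =
      vec_of_list [real a, real (Suc m), 1, of_bool (m < n)]" for a m
  proof -
    have "relu (1 + real n - (1 + real m)) - relu (real n - (1 + real m)) = of_bool (m < n)"
      by (auto simp: relu_def max_def)
    then show ?thesis
      by (simp add: udec_emb_def input_layer_def fnn_eval_net2 input_hidden_def lin_simps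
          of_rat_add relu_simps)
  qed
  then show ?thesis
    by (simp add: layer_step_comb_only input_layer_def embed_word_def te_of_def)
qed

section \<open>One-hot encoding of letters\<close>

text \<open>Letters \<open>1, \<dots>, k\<close> of the alphabet stand for \<open>0, \<dots>, k - 1\<close>; superfluous letters of the
  alphabet act as copies of the last one.\<close>

definition eff :: "nat \<Rightarrow> nat \<Rightarrow> nat" where
  "eff k a = min a k - 1"

text \<open>For an integer \<open>x\<close>, \<open>relu (x - j) - relu (x - (j + 1))\<close> is the
  indicator of \<open>j < x\<close>; the hidden layer below stores these two values at
  \<open>4 + j\<close> and \<open>5 + j\<close>.\<close>

definition step_row :: "nat \<Rightarrow> row" where
  "step_row j = radd (coord (4 + j)) (rscale (-1) (coord (5 + j)))"

text \<open>The indicator of a letter is a difference of consecutive step functions; for the last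
  letter the second one is dropped, which merges all larger letters with it. The first hidden row
  marks the first position: its average over a prefix is the reciprocal of the length.\<close>

definition one_hot_layer :: "nat \<Rightarrow> udec_layer" where
  "one_hot_layer k = \<lparr> ul_heads = [],
     ul_comb = net2 4
       ([radd (const 2) (rscale (-1) (coord 1)), coord 1, const 1, coord 3] @
        map (\<lambda>j. radd (coord 0) (const (- of_nat j))) [0..<Suc k])
       ([coord 0, coord 1, coord 2, coord 3] @
        map (\<lambda>j. if Suc j = k then step_row j
          else radd (step_row j) (rscale (-1) (step_row (Suc j)))) [0..<k]) \<rparr>"

definition one_hot :: "nat \<Rightarrow> nat \<Rightarrow> nat list \<Rightarrow> nat \<Rightarrow> real list" where
  "one_hot k n v m = [of_bool (m = 0), real (Suc m), 1, of_bool (m < n)] @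
     map (\<lambda>j. of_bool (v ! m = j)) [0..<k]"

lemma one_hot_layer:
  assumes "0 < k" "set w \<subseteq> {1..}"
  shows "layer_step (layer_of (one_hot_layer k))
      (map (\<lambda>m. vec_of_list [real (w ! m), real (Suc m), 1, of_bool (m < n)]) [0..<length w]) =
    map (\<lambda>m. vec_of_list (one_hot k n (map (eff k) w) m)) [0..<length w]"
proof -
  have eval: "fnn_eval (ul_comb (one_hot_layer k)) (vec_of_list [real a, real (Suc m), 1, of_bool (m < n)]) =
      vec_of_list ([of_bool (m = 0), real (Suc m), 1, of_bool (m < n)] @
        map (\<lambda>j. of_bool (eff k a = j)) [0..<k])"
    if "1 \<le> a" for a m
  proof -
    define h where "h = [of_bool (m = 0), real (Suc m), 1, of_bool (m < n)] @
      map (\<lambda>j. relu (real a - real j)) [0..<Suc k]"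
    define hs where "hs = [radd (const 2) (rscale (-1) (coord 1)), coord 1, const 1, coord 3] @
      map (\<lambda>j. radd (coord 0) (const (- of_nat j))) [0..<Suc k]"
    define row where "row j = (if Suc j = k then step_row j
      else radd (step_row j) (rscale (-1) (step_row (Suc j))))" for j
    have hidden: "map (\<lambda>h. relu (lin 4 h [real a, real (Suc m), 1, of_bool (m < n)])) hs = h"
      by (simp add: hs_def lin_simps h_def of_rat_minus relu_def del: upt_Suc)
    have len: "length hs = 5 + k" by (simp add: hs_def)
    have step: "lin (5 + k) (step_row j) h = of_bool (j < a)" if "j < k" for j
    proof -
      have "h ! (4 + j) = relu (real a - real j)" "h ! (5 + j) = relu (real a - real (Suc j))"
        using that by (simp_all add: h_def nth_append del: upt_Suc)
      with that show ?thesis by (simp add: step_row_def lin_simps) (auto simp: relu_def)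
    qed
    have "lin (5 + k) (row j) h = of_bool (eff k a = j)" if "j < k" for j
      using that \<open>1 \<le> a\<close> by (auto simp: row_def lin_radd lin_rscale step eff_def)
    moreover have "map (\<lambda>r. lin (5 + k) r h) [coord 0, coord 1, coord 2, coord 3] =
        [of_bool (m = 0), real (Suc m), 1, of_bool (m < n)]"
      by (simp add: lin_simps h_def)
    ultimately have rows: "map (\<lambda>r. lin (5 + k) r h)
        ([coord 0, coord 1, coord 2, coord 3] @ map row [0..<k]) =
        [of_bool (m = 0), real (Suc m), 1, of_bool (m < n)] @ map (\<lambda>j. of_bool (eff k a = j)) [0..<k]"
      unfolding map_append map_map by (intro arg_cong2[where f = "(@)"]) auto
    have comb: "ul_comb (one_hot_layer k) =
        net2 4 hs ([coord 0, coord 1, coord 2, coord 3] @ map row [0..<k])"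
      by (simp add: one_hot_layer_def hs_def row_def[abs_def] del: upt_Suc)
    have "length [real a, real (Suc m), 1, of_bool (m < n)] = 4" by simp
    then show ?thesis
      unfolding comb by (simp only: fnn_eval_net2 hidden len rows)
  qed
  then have "fnn_eval (ul_comb (one_hot_layer k))
      (vec_of_list [real (w ! m), real (Suc m), 1, of_bool (m < n)]) =
      vec_of_list (one_hot k n (map (eff k) w) m)" if "m < length w" for m
  proof -
    have "1 \<le> w ! m" using assms(2) nth_mem[OF that] by auto
    from eval[OF this, of m] show ?thesis
      by (simp only: one_hot_def nth_map[OF that])
  qed
  then show ?thesis
    by (simp add: layer_step_comb_only one_hot_layer_def)
qed

text \<open>For positions \<open>x\<close> and \<open>y\<close> the query is \<open>(x, 1)\<close>
  and the key \<open>(-1, y)\<close>. Their product \<open>y - x\<close> is at most 0 exactly for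
  the positions up to \<open>x\<close>.\<close>

definition prefix_head :: "nat \<Rightarrow> udec_head" where
  "prefix_head d = \<lparr> uh_query = row_mat d [coord 1, coord 2],
     uh_key = row_mat d [rscale (-1) (coord 2), coord 1],
     uh_net = below_net, uh_matrix = row_mat d (map coord [0..<d]) \<rparr>"

lemma uh_matrix_prefix_head: "uh_matrix (prefix_head d) = row_mat d (map coord [0..<d])"
  by (simp add: prefix_head_def)

lemma prefix_head_score:
  assumes "length x = d" "length y = d" "2 < d" "x ! 2 = 1" "y ! 2 = 1"
  shows "head_score (head_of (prefix_head d)) (vec_of_list x) (vec_of_list y) = - relu (y ! 1 - x ! 1)"
  using assms
  by (simp add: head_of_def prefix_head_def row_mat_mult lin_simps fnn_scalar_below_net)
    (simp add: coord_def rscale_def scalar_prod_def vec_of_list_index eval_nat_numeral)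

lemma attend_prefix:
  assumes X: "\<And>i. i < N \<Longrightarrow> length (X i) = d \<and> X i ! 1 = real (Suc i) \<and> X i ! 2 = 1"
    and "2 < d" "m < N"
  shows "attend (head_of (prefix_head d)) (map (\<lambda>i. vec_of_list (X i)) [0..<N]) (vec_of_list (X m)) =
    vec_of_list (map (\<lambda>r. (\<Sum>i\<le>m. X i ! r) / real (Suc m)) [0..<d])"
proof -
  have score: "head_score (head_of (prefix_head d)) (vec_of_list (X m)) (vec_of_list (X i)) =
      - relu (real i - real m)" if "i < N" for i
    using that X[of i] X[of m] assms(2,3) by (simp add: prefix_head_score)
  have val: "(real_mat (row_mat d (map coord [0..<d])) *\<^sub>v vec_of_list (X i)) $ r = X i ! r"
    if "i < N" "r < d" for i r
    using that X[of i] by (simp add: row_mat_mult vec_of_list_index lin_coord) (simp add: coord_def)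
  have "attend (head_of (prefix_head d)) (map (\<lambda>i. vec_of_list (X i)) [0..<N]) (vec_of_list (X m)) =
      vec d (\<lambda>r. (\<Sum>i\<le>m. (real_mat (row_mat d (map coord [0..<d])) *\<^sub>v
        (map (\<lambda>i. vec_of_list (X i)) [0..<N] ! i)) $ r) / card {..m})"
    by (subst attend_average[where S = "{..m}" and c = 0])
      (use assms(3) in \<open>auto simp: score relu_def uh_matrix_prefix_head\<close>)
  also have "\<dots> = vec_of_list (map (\<lambda>r. (\<Sum>i\<le>m. X i ! r) / real (Suc m)) [0..<d])"
    using assms(3) by (intro eq_vecI) (auto simp: vec_of_list_index val simp del: index_mult_mat_vec intro!: sum.cong)
  finally show ?thesis .
qed

section \<open>Counting constraints as conditions on prefix averages\<close>

definition weight :: "nat \<Rightarrow> constr \<Rightarrow> int" where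
  "weight k c = (case c of (j, a, b) \<Rightarrow> \<bar>b\<bar> + (\<Sum>l<k. \<bar>a l\<bar>))"

text \<open>The last summand switches the constraint off at positions that carry another letter; the
  prefix averages in the rest are bounded by \<open>weight k c\<close>.\<close>

definition constr_row :: "nat \<Rightarrow> constr \<Rightarrow> row" where
  "constr_row k c = (case c of (j, a, b) \<Rightarrow>
     radd (rscale (-1) (radd (rsum k (\<lambda>l. rscale (of_int (a l)) (coord (k + 4 + (4 + l)))))
         (rscale (of_int b) (coord (k + 4)))))
       (rscale (of_int (weight k c)) (radd (coord (4 + j)) (const (-1)))))"

definition averages :: "nat \<Rightarrow> nat \<Rightarrow> nat list \<Rightarrow> nat \<Rightarrow> real list" where
  "averages k n v m = map (\<lambda>r. (\<Sum>i\<le>m. one_hot k n v i ! r) / real (Suc m)) [0..<k + 4]"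

lemma length_one_hot [simp]: "length (one_hot k n v m) = k + 4"
  by (simp add: one_hot_def)

lemma one_hot_nth: "one_hot k n v m ! 0 = of_bool (m = 0)" "one_hot k n v m ! 1 = real (Suc m)"
  "one_hot k n v m ! 2 = 1" "one_hot k n v m ! 3 = of_bool (m < n)"
  "l < k \<Longrightarrow> one_hot k n v m ! (4 + l) = of_bool (v ! m = l)"
  by (simp_all add: one_hot_def)

text \<open>Dividing a constraint by the prefix length turns letter counts into averages, and its
  constant \<open>b\<close> into \<open>b\<close> times the average at index 0. The sign is reversed
  so that a violation becomes positive.\<close>

lemma lin_constr_row:
  assumes "j < k" "set v \<subseteq> {..<k}" "m < length v"
  shows "lin (k + 4 + (k + 4)) (constr_row k (j, a, b)) (one_hot k n v m @ averages k n v m) =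
    - of_int ((\<Sum>i\<le>m. a (v ! i)) + b) / real (Suc m) -
      of_int (weight k (j, a, b)) * of_bool (v ! m \<noteq> j)"
proof -
  let ?z = "one_hot k n v m @ averages k n v m"
  have z0: "?z ! (k + 4) = 1 / real (Suc m)"
    by (simp add: nth_append averages_def one_hot_nth sum.delta' flip: of_bool_def)
  have zl: "?z ! (k + 4 + (4 + l)) = (\<Sum>i\<le>m. of_bool (v ! i = l)) / real (Suc m)" if "l < k" for l
    using that by (simp add: nth_append averages_def one_hot_nth)
  have zj: "?z ! (4 + j) = of_bool (v ! m = j)"
    using assms(1) by (simp add: nth_append one_hot_nth)
  \<comment> \<open>Weighting the counts of the letters amounts to adding up weights along the
    prefix.\<close>
  have "(\<Sum>l<k. of_int (a l) * (\<Sum>i\<le>m. of_bool (v ! i = l))) =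
      (\<Sum>i\<le>m. \<Sum>l<k. of_int (a l) * of_bool (v ! i = l) :: real)"
    unfolding sum_distrib_left by (rule sum.swap)
  also have "\<dots> = (\<Sum>i\<le>m. of_int (a (v ! i)))"
  proof (rule sum.cong[OF refl])
    fix i assume "i \<in> {..m}"
    then have "v ! i < k" using assms(2,3) by (auto simp: subset_iff)
    then show "(\<Sum>l<k. of_int (a l) * of_bool (v ! i = l) :: real) = of_int (a (v ! i))"
      by (simp add: of_bool_def sum.delta if_distrib cong: if_cong)
  qed
  finally have sums: "(\<Sum>l<k. of_int (a l) * (\<Sum>i\<le>m. of_bool (v ! i = l))) =
      (\<Sum>i\<le>m. of_int (a (v ! i)) :: real)" .
  have "lin (k + 4 + (k + 4)) (constr_row k (j, a, b)) ?z =
      - ((\<Sum>l<k. of_int (a l) * ?z ! (k + 4 + (4 + l))) + of_int b * ?z ! (k + 4)) +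
        of_int (weight k (j, a, b)) * (?z ! (4 + j) - 1)"
    using assms(1) by (simp add: constr_row_def lin_simps of_rat_minus)
  also have "(\<Sum>l<k. of_int (a l) * ?z ! (k + 4 + (4 + l))) =
      (\<Sum>i\<le>m. of_int (a (v ! i))) / real (Suc m)"
  proof -
    have "(\<Sum>l<k. of_int (a l) * ?z ! (k + 4 + (4 + l))) =
        (\<Sum>l<k. of_int (a l) * (\<Sum>i\<le>m. of_bool (v ! i = l)) / real (Suc m))"
      by (rule sum.cong[OF refl], subst zl) auto
    then show ?thesis
      by (simp only: sum_divide_distrib[symmetric] sums)
  qed
  finally have "lin (k + 4 + (k + 4)) (constr_row k (j, a, b)) ?z =
      - ((\<Sum>i\<le>m. of_int (a (v ! i))) / real (Suc m) + of_int b * (1 / real (Suc m))) +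
        of_int (weight k (j, a, b)) * (of_bool (v ! m = j) - 1)"
    by (simp only: z0 zj)
  also have "(\<Sum>i\<le>m. of_int (a (v ! i))) / real (Suc m) + of_int b * (1 / real (Suc m)) =
      of_int ((\<Sum>i\<le>m. a (v ! i)) + b) / real (Suc m)"
    by (simp add: add_divide_distrib)
  finally show ?thesis
    unfolding minus_divide_left[symmetric] by (cases "v ! m = j") simp_all
qed

text \<open>Division by the prefix length preserves the sign. At another letter the penalty
  dominates: an average of values of \<open>a\<close> is at most the sum of their absolute values in
  size, and \<open>b\<close> only shrinks under division.\<close>

lemma lin_constr_row_le_0:
  assumes "j < k" "set v \<subseteq> {..<k}" "m < length v"
  shows "lin (k + 4 + (k + 4)) (constr_row k (j, a, b)) (one_hot k n v m @ averages k n v m) \<le> 0 \<longleftrightarrow>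
    (v ! m = j \<longrightarrow> 0 \<le> (\<Sum>i\<le>m. a (v ! i)) + b)"
proof (cases "v ! m = j")
  case True
  have "- of_int x / real (Suc m) \<le> 0 \<longleftrightarrow> 0 \<le> x" for x :: int
    by (simp add: divide_le_0_iff zero_le_divide_iff)
  with True show ?thesis
    unfolding lin_constr_row[OF assms] by (simp del: of_int_add of_int_sum of_nat_Suc)
next
  case False
  define A where "A = (\<Sum>l<k. \<bar>a l\<bar>)"
  have "\<bar>a (v ! i)\<bar> \<le> A" if "i \<le> m" for i
  proof -
    have "v ! i < k" using assms(2,3) that by (auto simp: subset_iff)
    then show ?thesis unfolding A_def by (intro member_le_sum) auto
  qed
  then have "\<bar>\<Sum>i\<le>m. a (v ! i)\<bar> \<le> (\<Sum>i\<le>m. A)"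
    by (intro order_trans[OF sum_abs] sum_mono) auto
  then have "\<bar>\<Sum>i\<le>m. a (v ! i)\<bar> \<le> int (Suc m) * A" by simp
  moreover have "\<bar>b\<bar> \<le> int (Suc m) * \<bar>b\<bar>"
    using mult_right_mono[of 1 "int (Suc m)" "\<bar>b\<bar>"] by simp
  moreover have "int (Suc m) * weight k (j, a, b) = int (Suc m) * \<bar>b\<bar> + int (Suc m) * A"
    by (simp add: weight_def A_def[symmetric] distrib_left)
  ultimately have "- ((\<Sum>i\<le>m. a (v ! i)) + b) \<le> int (Suc m) * weight k (j, a, b)"
    by linarith
  then have "- of_int ((\<Sum>i\<le>m. a (v ! i)) + b) \<le> real (Suc m) * of_int (weight k (j, a, b))"
    by (metis of_int_le_iff of_int_minus of_int_mult of_int_of_nat_eq)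
  then have "- of_int ((\<Sum>i\<le>m. a (v ! i)) + b) / real (Suc m) \<le> of_int (weight k (j, a, b))"
    by (simp only: pos_divide_le_eq[OF of_nat_0_less_iff[THEN iffD2, OF zero_less_Suc]] mult.commute)
  with False show ?thesis
    unfolding lin_constr_row[OF assms] by simp
qed

text \<open>The output is \<open>[fin, err]\<close>: \<open>fin\<close> tells whether the letter is the last one of the
  alphabet, and \<open>err\<close> is \<open>0\<close> iff no condition is violated here.\<close>

definition check_rows :: "nat \<Rightarrow> constr list \<Rightarrow> row list" where
  "check_rows k G = [radd (coord 3) (rscale (-1) (coord 4)), radd (coord 4) (rscale (-1) (coord 3))] @
     map (constr_row k) G"

definition check_layer :: "nat \<Rightarrow> constr list \<Rightarrow> udec_layer" where
  "check_layer k G = \<lparr> ul_heads = [prefix_head (k + 4)],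
     ul_comb = net2 (k + 4 + (k + 4)) (coord (k + 3) # check_rows k G)
       [coord 0, rsum (length (check_rows k G)) (\<lambda>i. coord (Suc i))] \<rparr>"

definition err :: "nat \<Rightarrow> constr list \<Rightarrow> nat \<Rightarrow> nat list \<Rightarrow> nat \<Rightarrow> real" where
  "err k G n v m = sum_list (map (\<lambda>r. relu (lin (k + 4 + (k + 4)) r
     (one_hot k n v m @ averages k n v m))) (check_rows k G))"

lemma err_nonneg: "0 \<le> err k G n v m"
  unfolding err_def by (rule sum_list_nonneg) (auto simp: relu_simps)

text \<open>A sum of \<open>relu\<close> values is 0 iff no row is positive. The two opposite rows
  together force equality between the indicator of letter 0 and that of
  \<open>m < n\<close>.\<close>

lemma err_eq_0_iff:
  assumes "0 < k" "\<forall>(j, a, b)\<in>set G. j < k" "set v \<subseteq> {..<k}" "m < length v"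
  shows "err k G n v m = 0 \<longleftrightarrow> (v ! m = 0 \<longleftrightarrow> m < n) \<and>
    (\<forall>(j, a, b)\<in>set G. v ! m = j \<longrightarrow> 0 \<le> (\<Sum>i\<le>m. a (v ! i)) + b)"
proof -
  let ?z = "one_hot k n v m @ averages k n v m"
  have z: "?z ! 3 = of_bool (m < n)" "?z ! 4 = of_bool (v ! m = 0)"
    using one_hot_nth(5)[of 0 k n v m] assms(1) by (simp_all add: nth_append one_hot_nth)
  have "err k G n v m = 0 \<longleftrightarrow> (\<forall>r\<in>set (check_rows k G). lin (k + 4 + (k + 4)) r ?z \<le> 0)"
    unfolding err_def by (subst sum_list_nonneg_eq_0_iff) (auto simp: relu_simps)
  also have "\<dots> \<longleftrightarrow> (v ! m = 0 \<longleftrightarrow> m < n) \<and>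
      (\<forall>c\<in>set G. lin (k + 4 + (k + 4)) (constr_row k c) ?z \<le> 0)"
    by (auto simp: check_rows_def lin_simps z)
  also have "(\<forall>c\<in>set G. lin (k + 4 + (k + 4)) (constr_row k c) ?z \<le> 0) \<longleftrightarrow>
      (\<forall>(j, a, b)\<in>set G. v ! m = j \<longrightarrow> 0 \<le> (\<Sum>i\<le>m. a (v ! i)) + b)"
  proof (rule ball_cong[OF refl])
    fix c assume "c \<in> set G"
    moreover obtain j a b where c: "c = (j, a, b)" by (cases c)
    ultimately have "j < k" using assms(2) by auto
    then show "lin (k + 4 + (k + 4)) (constr_row k c) ?z \<le> 0 \<longleftrightarrow>
        (case c of (j, a, b) \<Rightarrow> v ! m = j \<longrightarrow> 0 \<le> (\<Sum>i\<le>m. a (v ! i)) + b)"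
      unfolding c prod.case by (rule lin_constr_row_le_0[OF _ assms(3,4)])
  qed
  finally show ?thesis .
qed

lemma check_layer:
  assumes "0 < k" "N = length v"
  shows "layer_step (layer_of (check_layer k G)) (map (\<lambda>m. vec_of_list (one_hot k n v m)) [0..<N]) =
    map (\<lambda>m. vec_of_list [of_bool (v ! m = k - 1), err k G n v m]) [0..<N]"
proof -
  have "fnn_eval (ul_comb (check_layer k G)) (vec_of_list (one_hot k n v m @ averages k n v m)) =
      vec_of_list [of_bool (v ! m = k - 1), err k G n v m]" for m
  proof -
    let ?z = "one_hot k n v m @ averages k n v m"
    let ?c = "k + 4 + (k + 4)"
    let ?h = "map (\<lambda>r. relu (lin ?c r ?z)) (coord (k + 3) # check_rows k G)"
    have "?z ! (k + 3) = of_bool (v ! m = k - 1)"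
      using one_hot_nth(5)[of "k - 1" k n v m] assms(1)
      by (simp add: nth_append add.commute[of k 3])
    then have fin: "lin (Suc (length (check_rows k G))) (coord 0) ?h = of_bool (v ! m = k - 1)"
      by (simp add: lin_coord relu_simps)
    have err: "lin (Suc (length (check_rows k G)))
        (rsum (length (check_rows k G)) (\<lambda>i. coord (Suc i))) ?h = err k G n v m"
      by (simp add: lin_simps err_def sum_list_sum_nth lessThan_atLeast0)
    have "fnn_eval (ul_comb (check_layer k G)) (vec_of_list ?z) =
        vec_of_list [lin (Suc (length (check_rows k G))) (coord 0) ?h,
          lin (Suc (length (check_rows k G)))
            (rsum (length (check_rows k G)) (\<lambda>i. coord (Suc i))) ?h]"
      by (subst (1) check_layer_def) (simp add: fnn_eval_net2 averages_def)
    then show ?thesis by (simp only: fin err)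
  qed
  moreover have "attend (head_of (prefix_head (k + 4))) (map (\<lambda>m. vec_of_list (one_hot k n v m)) [0..<N])
      (vec_of_list (one_hot k n v m)) = vec_of_list (averages k n v m)" if "m < N" for m
    unfolding averages_def using that assms(1) by (intro attend_prefix) (auto simp: one_hot_nth(3) one_hot_nth(2)[simplified])
  ultimately show ?thesis
    by (subst layer_step_one_head[of _ "prefix_head (k + 4)"])
      (auto simp: check_layer_def list_vec)
qed

text \<open>Query and key matrices without rows make all scores equal, so the head averages the
  errors over the whole word.\<close>

definition average_head :: udec_head where
  "average_head = \<lparr> uh_query = row_mat 2 [], uh_key = row_mat 2 [], uh_net = below_net,
     uh_matrix = row_mat 2 [coord 1] \<rparr>"

text \<open>Only the last position reaches the output, so the errors of all positions have to be
  brought there. They are non-negative, so subtracting their average leaves 1 only if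
  \<open>fin\<close> holds and no error occurs.\<close>

definition verdict_layer :: udec_layer where
  "verdict_layer = \<lparr> ul_heads = [average_head],
     ul_comb = net1 3 [radd (coord 0) (rscale (-1) (coord 2))] \<rparr>"

lemma verdict_layer:
  assumes "0 < N"
  shows "layer_step (layer_of verdict_layer) (map (\<lambda>m. vec_of_list [f m, e m]) [0..<N]) =
    map (\<lambda>m. vec_of_list [f m - (\<Sum>i<N. e i) / real N]) [0..<N]"
proof -
  have "head_score (head_of average_head) (vec_of_list [a, b]) (vec_of_list [c, d]) = 0" for a b c d
    by (simp add: head_of_def average_head_def row_mat_mult fnn_scalar_below_net)
      (simp add: scalar_prod_def relu_def)
  then have "attend (head_of average_head) (map (\<lambda>m. vec_of_list [f m, e m]) [0..<N]) (vec_of_list [f m, e m]) =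
      vec 1 (\<lambda>r. (\<Sum>i<N. (real_mat (row_mat 2 [coord 1]) *\<^sub>v
        (map (\<lambda>m. vec_of_list [f m, e m]) [0..<N] ! i)) $ r) / card {..<N})" for m
    by (subst attend_average[where S = "{..<N}" and c = 0])
      (use assms in \<open>auto simp: average_head_def\<close>)
  also have "\<dots> = vec_of_list [(\<Sum>i<N. e i) / real N]"
    by (rule eq_vecI) (auto simp: vec_of_list_index row_mat_mult lin_coord, simp add: coord_def)
  finally show ?thesis
    by (subst layer_step_one_head[of _ average_head])
      (auto simp: verdict_layer_def list_vec fnn_eval_net1 lin_simps)
qed

section \<open>The complete encoder\<close>

definition check_layers :: "nat \<Rightarrow> constr list \<Rightarrow> udec_layer list" where
  "check_layers k G = [one_hot_layer k, check_layer k G, verdict_layer]"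

definition out_net :: fnn where
  "out_net = net1 1 [coord 0]"

text \<open>The alphabet size \<open>s\<close> is separate from \<open>k\<close> because the
  diagonal argument needs one computable from \<open>n\<close>; it will be
  \<open>Suc n\<close>.\<close>

definition encoder :: "nat \<Rightarrow> nat \<Rightarrow> udec_layer list \<Rightarrow> udec_te" where
  "encoder n s ls = \<lparr> ut_size = s, ut_layers = input_layer n # ls, ut_out = out_net \<rparr>"

lemma count_lang_iff:
  "count_lang G v \<longleftrightarrow> (\<forall>m<length v. \<forall>(j, a, b)\<in>set G. v ! m = j \<longrightarrow> 0 \<le> (\<Sum>i\<le>m. a (v ! i)) + b)"
proof -
  have "sum_list (map a (take (Suc m) v)) = (\<Sum>i\<le>m. a (v ! i))" if "m < length v"
    for m and a :: "nat \<Rightarrow> int"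
    using Suc_leI[OF that]
    by (simp add: sum_list_sum_nth min_absorb2 lessThan_Suc_atMost flip: lessThan_atLeast0)
  then show ?thesis by (simp add: count_lang_def)
qed

lemma te_run_encoder:
  assumes "0 < k" "\<forall>(j, a, b)\<in>set G. j < k" "w \<noteq> []" "set w \<subseteq> {1..}"
  shows "te_run (te_of (encoder n s (check_layers k G))) w = 1 \<longleftrightarrow> halt_word k G n (map (eff k) w)"
proof -
  define v where "v = map (eff k) w"
  have v: "v \<noteq> []" "set v \<subseteq> {..<k}" "length w = length v"
    using assms by (auto simp: v_def eff_def)
  define total where "total = (\<Sum>i<length v. err k G n v i)"
  have "fold layer_step (te_layers (te_of (encoder n s (check_layers k G))))
      (embed_word (te_of (encoder n s (check_layers k G))) w) =
      map (\<lambda>m. vec_of_list [of_bool (v ! m = k - 1) - total / real (length v)]) [0..<length v]"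
    using v(1) assms(1) input_layer[of n "encoder n s (check_layers k G)" w]
      one_hot_layer[OF assms(1,4), of n]
    by (simp add: te_of_def encoder_def check_layers_def v_def[symmetric] v(3) check_layer
        verdict_layer total_def)
  then have "te_run (te_of (encoder n s (check_layers k G))) w =
      of_bool (last v = k - 1) - total / real (length v)"
    using v(1) by (simp add: te_run_def) (simp add: te_of_def encoder_def out_net_def fnn_scalar_def
      fnn_eval_net1 lin_simps vec_of_list_index last_map last_conv_nth)
  moreover have "0 \<le> total" "total = 0 \<longleftrightarrow> (\<forall>m<length v. err k G n v m = 0)"
    unfolding total_def by (auto simp: sum_nonneg err_nonneg sum_nonneg_eq_0_iff)
  moreover have "of_bool q - x / real (length v) = 1 \<longleftrightarrow> q \<and> x = 0" if "0 \<le> x" for q x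
  proof (cases q)
    case False
    have "0 \<le> x / real (length v)" using that by simp
    with False show ?thesis by (simp del: zero_le_divide_iff)
  qed (use v(1) in simp)
  ultimately have "te_run (te_of (encoder n s (check_layers k G))) w = 1 \<longleftrightarrow>
      last v = k - 1 \<and> (\<forall>m<length v. err k G n v m = 0)"
    by simp
  then show ?thesis
    using v assms(2) unfolding v_def[symmetric]
    by (auto simp: halt_word_def count_lang_iff err_eq_0_iff[OF assms(1,2)])
qed

lemma trSat_encoder:
  assumes "0 < k" "\<forall>(j, a, b)\<in>set G. j < k" "k \<le> s"
  shows "trSat (encoder n s (check_layers k G)) \<longleftrightarrow> (\<exists>w. halt_word k G n w)"
proof -
  have "trSat (encoder n s (check_layers k G)) \<longleftrightarrow>
      (\<exists>w. w \<noteq> [] \<and> set w \<subseteq> {1..s} \<and> halt_word k G n (map (eff k) w))"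
  proof -
    have "te_run (te_of (encoder n s (check_layers k G))) w = 1 \<longleftrightarrow> halt_word k G n (map (eff k) w)"
      if "w \<noteq> []" "set w \<subseteq> {1..s}" for w
      using that assms(1,2) by (intro te_run_encoder) auto
    then show ?thesis
      unfolding trSat_def te_satisfiable_def
      by (auto simp: te_of_def encoder_def)
  qed
  also have "\<dots> \<longleftrightarrow> (\<exists>w. halt_word k G n w)"
  proof
    assume "\<exists>w. halt_word k G n w"
    then obtain w where w: "halt_word k G n w" by blast
    \<comment> \<open>Shifting by \<open>Suc\<close> is a right inverse of \<open>eff k\<close> on
      the letters below \<open>k\<close>.\<close>
    then have "map (eff k) (map Suc w) = w"
      by (auto simp: halt_word_def eff_def subset_iff intro!: map_idI)
    with w have "map Suc w \<noteq> [] \<and> set (map Suc w) \<subseteq> {1..s} \<and> halt_word k G n (map (eff k) (map Suc w))"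
      using assms(3) by (auto simp: halt_word_def subset_iff)
    then show "\<exists>w. w \<noteq> [] \<and> set w \<subseteq> {1..s} \<and> halt_word k G n (map (eff k) w)" by blast
  qed auto
  finally show ?thesis .
qed

lemma layers_wf_check_layers: "layers_wf 4 1 (check_layers k G)"
proof -
  have "layer_wf 4 (k + 4) (one_hot_layer k)"
    by (simp add: layer_wf_def one_hot_layer_def)
  moreover have "layer_wf (k + 4) 2 (check_layer k G)"
    by (simp add: layer_wf_def check_layer_def head_wf_def prefix_head_def below_net_def)
  moreover have "layer_wf 2 1 verdict_layer"
    by (simp add: layer_wf_def verdict_layer_def head_wf_def average_head_def below_net_def)
  ultimately show ?thesis
    by (auto simp: check_layers_def)
qed

lemma encoder_in_T_udec:
  assumes "1 \<le> s"
  shows "encoder n s (check_layers k G) \<in> T_udec"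
proof -
  have "layer_wf 5 4 (input_layer n)"
    by (simp add: layer_wf_def input_layer_def)
  with layers_wf_check_layers[of k G] have "layers_wf 5 1 (ut_layers (encoder n s (check_layers k G)))"
    by (auto simp: encoder_def)
  with assms show ?thesis
    unfolding T_udec_def
    by (intro CollectI conjI exI[of _ 1]) (simp_all add: encoder_def out_net_def)
qed

section \<open>Codes of encoders and diagonalisation\<close>

lemma computes_Comp1: "computes g xs y \<Longrightarrow> computes f [y] z \<Longrightarrow> computes (Comp f [g]) xs z"
  by (rule computes.Comp[of "[y]"]) auto

lemma computes_Comp2:
  "computes g xs y \<Longrightarrow> computes h xs y' \<Longrightarrow> computes f [y, y'] z \<Longrightarrow> computes (Comp f [g, h]) xs z"
  by (rule computes.Comp[of "[y, y']"]) (auto simp: less_Suc_eq)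

definition computable :: "(nat \<Rightarrow> nat) \<Rightarrow> bool" where
  "computable F \<longleftrightarrow> (\<exists>f. \<forall>n. computes f [n] (F n))"

lemma computable_id: "computable (\<lambda>n. n)"
  unfolding computable_def
  by (rule exI[of _ "Proj 0"]) (use computes.Proj[of 0] in fastforce)

lemma computable_Suc: "computable F \<Longrightarrow> computable (\<lambda>n. Suc (F n))"
  unfolding computable_def using computes_Comp1 computes.Succ by meson

lemma computable_const: "computable (\<lambda>_. c)"
proof (induction c)
  case 0
  show ?case unfolding computable_def using computes.Zero by blast
qed (rule computable_Suc)

definition add_rec :: recf where
  "add_rec = PrimRec (Proj 0) (Comp Succ [Proj 0])"

lemma computes_add_rec: "computes add_rec [m, n] (m + n)"
proof (induction m)
  case 0
  show ?case
    unfolding add_rec_def using computes.Proj[of 0 "[n]"] by (auto intro: computes.PrimRec_0)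
next
  case (Suc m)
  have "computes (Comp Succ [Proj 0]) [m + n, m, n] (Suc (m + n))"
    using computes.Proj[of 0 "[m + n, m, n]"] by (auto intro: computes_Comp1 computes.Succ)
  with Suc show ?case
    unfolding add_rec_def by (auto intro: computes.PrimRec_Suc)
qed

definition triangle_rec :: recf where
  "triangle_rec = PrimRec Zero (Comp Succ [Comp add_rec [Proj 0, Proj 1]])"

lemma computes_triangle_rec: "computes triangle_rec [n] (triangle n)"
proof (induction n)
  case 0
  show ?case unfolding triangle_rec_def by (auto intro: computes.intros)
next
  case (Suc n)
  have "computes (Comp add_rec [Proj 0, Proj 1]) [triangle n, n] (triangle n + n)"
    using computes.Proj[of 0 "[triangle n, n]"] computes.Proj[of 1 "[triangle n, n]"]
    by (auto intro: computes_Comp2 computes_add_rec)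
  then have "computes (Comp Succ [Comp add_rec [Proj 0, Proj 1]]) [triangle n, n] (triangle (Suc n))"
    by (auto intro: computes_Comp1 computes.Succ)
  with Suc show ?case
    unfolding triangle_rec_def by (rule computes.PrimRec_Suc)
qed

lemma computable_add: "computable F \<Longrightarrow> computable G \<Longrightarrow> computable (\<lambda>n. F n + G n)"
  unfolding computable_def using computes_Comp2 computes_add_rec by meson

lemma computable_triangle: "computable F \<Longrightarrow> computable (\<lambda>n. triangle (F n))"
  unfolding computable_def using computes_Comp1 computes_triangle_rec by meson

lemma computable_pair:
  "computable F \<Longrightarrow> computable G \<Longrightarrow> computable (\<lambda>n. prod_encode (F n, G n))"
  unfolding prod_encode_def by (simp add: computable_add computable_triangle)

section \<open>Codes of encoders as functions of \<open>n\<close>\<close>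

lemma rat_code_of_nat: "rat_code (of_nat n) = prod_encode (n + n, int_encode 1)"
  by (simp add: rat_code_def int_encode_def sum_encode_def)

lemma computable_rat_code: "computable F \<Longrightarrow> computable (\<lambda>n. rat_code (of_nat (F n)))"
  unfolding rat_code_of_nat by (intro computable_pair computable_add computable_const)

lemma length_input_hidden: "length (input_hidden n) = 5"
  by (simp add: input_hidden_def)

text \<open>Since \<open>n\<close> enters through the bias only, the code of the weight matrix is a
  constant.\<close>

lemma row_mat_input_hidden: "row_mat 5 (input_hidden n) = row_mat 5 (input_hidden 0)"
proof -
  have "map fst (input_hidden n) = map fst (input_hidden 0)"
    by (simp add: input_hidden_def radd_def const_def)
  moreover have "row_mat 5 rs = mat (length (map fst rs)) 5 (\<lambda>(i, j). (map fst rs ! i) j)" for rs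
    by (auto simp: row_mat_def)
  ultimately show ?thesis by (simp only:)
qed

lemma vec_code_input_hidden: "vec_code (row_bias (input_hidden n)) =
   list_encode (map rat_code [0, 0, 1, of_nat (Suc n), of_nat n])"
  by (simp add: vec_code_def row_bias_def input_hidden_def coord_def const_def radd_def rscale_def
      list_of_vec_vec upt_conv_Cons)

text \<open>The code of a list pairs the code of its head with that of its tail, and the tail
  \<open>ls\<close> has code \<open>n\<close> by assumption. So nothing needs to be decoded, and
  pairing, successor and constants suffice.\<close>

lemma computable_encoder_code:
  "\<exists>F. computable F \<and> (\<forall>n ls. list_encode (map layer_code ls) = n \<longrightarrow>
     udec_code (encoder n (Suc n) ls) = F n)"
proof -
  define os where "os = [coord 0, coord 1, coord 2, radd (coord 3) (rscale (-1) (coord 4))]"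
  define L where "L n = prod_encode (list_encode [], list_encode [mat_code (row_mat 5 (input_hidden 0)),
    list_encode [rat_code 0, rat_code 0, rat_code 1, rat_code (of_nat (Suc n)), rat_code (of_nat n)],
    fnn_code (net1 5 os)])" for n
  define F where "F n = list_encode [Suc n, Suc (prod_encode (L n, n)), fnn_code out_net]" for n
  have "layer_code (input_layer n) = L n" for n
    by (simp add: layer_code_def input_layer_def net2_def row_mat_input_hidden[of n]
        length_input_hidden vec_code_input_hidden L_def os_def del: list_encode.simps of_nat_Suc)
  then have "udec_code (encoder n (Suc n) ls) = F n" if "list_encode (map layer_code ls) = n" for n ls
    by (simp add: udec_code_def encoder_def F_def that)
  moreover have "computable L"
    unfolding L_def list_encode.simps
    by (intro computable_pair computable_Suc computable_const computable_rat_code computable_id)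
  then have "computable F"
    unfolding F_def list_encode.simps
    by (intro computable_pair computable_Suc computable_const computable_id)
  ultimately show ?thesis by blast
qed

lemma le_list_encode: "x \<in> set xs \<Longrightarrow> x \<le> list_encode xs"
  by (induction xs) (auto intro: le_SucI order_trans le_prod_encode_1 le_prod_encode_2)

lemma length_le_list_encode: "length xs \<le> list_encode xs"
  by (induction xs) (auto intro: order_trans le_prod_encode_2)

text \<open>This makes \<open>{1..Suc n}\<close> a large enough alphabet. Codes bound list lengths
  and components, and a bias vector of the one-hot layer has \<open>k + 5\<close> entries.\<close>

lemma size_le_code: "k \<le> list_encode (map layer_code (check_layers k G))"
proof -
  obtain A b N where comb: "ul_comb (one_hot_layer k) = Hidden A b N" and "dim_vec b = k + 5"
    by (simp add: one_hot_layer_def net2_def row_bias_def)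
  then have "k \<le> vec_code b"
    using length_le_list_encode[of "map rat_code (list_of_vec b)"] by (simp add: vec_code_def)
  also have "\<dots> \<le> fnn_code (ul_comb (one_hot_layer k))"
    unfolding comb fnn_code.simps by (rule le_list_encode) simp
  also have "\<dots> \<le> layer_code (one_hot_layer k)"
    unfolding layer_code_def by (rule le_prod_encode_2)
  also have "\<dots> \<le> list_encode (map layer_code (check_layers k G))"
    by (rule le_list_encode) (simp add: check_layers_def)
  finally show ?thesis .
qed

theorem theorem1:
  shows "\<not> decidable_problem udec_code T_udec trSat"
proof
  assume "decidable_problem udec_code T_udec trSat"
  then obtain f where f: "\<And>p. p \<in> T_udec \<Longrightarrow> computes f [udec_code p] (if trSat p then 1 else 0)"
    unfolding decidable_problem_def by blast
  obtain F g where F: "\<And>n ls. list_encode (map layer_code ls) = n \<Longrightarrow>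
      udec_code (encoder n (Suc n) ls) = F n" and g: "\<And>n. computes g [n] (F n)"
    using computable_encoder_code unfolding computable_def by blast
  \<comment> \<open>\<open>Mu\<close> searches over the first argument, while \<open>q\<close> looks
    at the second only: \<open>Mu q\<close> halts on \<open>n\<close> iff \<open>f\<close> returns 0
    on \<open>F n\<close>.\<close>
  define q where "q = Comp f [Comp g [Proj 1]]"
  have q: "computes q [m, n] y" if "computes f [F n] y" for m n y
    unfolding q_def using computes.Proj[of 1 "[m, n]"]
    by (auto intro!: computes_Comp1 g that)
  obtain k G where kG: "0 < k" "\<forall>(j, a, b)\<in>set G. j < k"
    "\<And>n. (\<exists>y. computes (Mu q) [n] y) \<longleftrightarrow> (\<exists>w. halt_word k G n w)"
    using computes_iff_halt_word[of "Mu q"] by blast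
  \<comment> \<open>The diagonal choice: the input is the code of the layers built for
    \<open>Mu q\<close> itself.\<close>
  define n where "n = list_encode (map layer_code (check_layers k G))"
  define P where "P = encoder n (Suc n) (check_layers k G)"
  have "P \<in> T_udec"
    unfolding P_def by (rule encoder_in_T_udec) simp
  moreover have "udec_code P = F n"
    unfolding P_def by (rule F) (simp add: n_def)
  ultimately have decide: "computes f [F n] (if trSat P then 1 else 0)"
    using f by metis
  have halts: "trSat P \<longleftrightarrow> (\<exists>y. computes (Mu q) [n] y)"
    unfolding P_def kG(3) using kG(1,2) size_le_code[of k G]
    by (intro trSat_encoder) (auto simp: n_def)
  show False
  proof (cases "trSat P")
    case True
    \<comment> \<open>The answer 1 would keep the search from ever succeeding.\<close>
    with halts obtain y where "computes q [y, n] 0" by (auto simp: computes_Mu)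
    moreover from True decide have "computes q [y, n] 1" by (auto intro: q)
    ultimately show False using computes_deterministic by force
  next
    case False
    \<comment> \<open>The answer 0 ends the search at its first candidate.\<close>
    with decide have "computes q [0, n] 0" by (auto intro: q)
    then have "computes (Mu q) [n] 0" by (auto intro: computes.Mu)
    with False halts show False by blast
  qed
qed

end
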